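(* For every connected planar graph $G$ we have $c_2(G)\le 3$.
   Context: Cops and robber game on a finite connected graph $G$: the cops first choose starting vertices, then the robber chooses his; then they alternate turns, each player moving pieces to adjacent vertices or staying; the cops win if some cop eventually occupies the robber's vertex. For a positive integer $k$, $c_k(G)$ is the smallest integer $t$ such that $t$ cops can guarantee capture of the robber on $G$ under the additional restriction that in each cops' turn at most $k$ cops change their position. *)

theory Defs
  imports "HOL-Analysis.Analysis"
begin

(* A finite simple graph is given by a vertex set V and an edge relation E. *)
definition simple_graph :: "'a set \<Rightarrow> ('a \<Rightarrow> 'a \<Rightarrow> bool) \<Rightarrow> bool" where
  "simple_graph V E \<longleftrightarrow> finite V \<and>
     (\<forall>u v. E u v \<longrightarrow> u \<in> V \<and> v \<in> V) \<and>
     (\<forall>u v. E u v \<longrightarrow> E v u) \<and> (\<forall>u. \<not> E u u)"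

definition connected_graph :: "'a set \<Rightarrow> ('a \<Rightarrow> 'a \<Rightarrow> bool) \<Rightarrow> bool" where
  "connected_graph V E \<longleftrightarrow> V \<noteq> {} \<and>
     (\<forall>u\<in>V. \<forall>v\<in>V. (u, v) \<in> {(x, y). x \<in> V \<and> y \<in> V \<and> E x y}\<^sup>*)"

definition graph_edges :: "'a set \<Rightarrow> ('a \<Rightarrow> 'a \<Rightarrow> bool) \<Rightarrow> 'a set set" where
  "graph_edges V E = {{u, v} | u v. u \<in> V \<and> v \<in> V \<and> E u v}"

(* Planarity: a drawing in the plane (= complex numbers) with distinct points for the
   vertices, an arc for every edge joining its end points and meeting no other vertex,
   and any two distinct edge arcs meeting at most in common end points. *)
definition planar_graph :: "'a set \<Rightarrow> ('a \<Rightarrow> 'a \<Rightarrow> bool) \<Rightarrow> bool" where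
  "planar_graph V E \<longleftrightarrow>
    (\<exists>(p :: 'a \<Rightarrow> complex) (\<gamma> :: 'a set \<Rightarrow> real \<Rightarrow> complex).
       inj_on p V \<and>
       (\<forall>e\<in>graph_edges V E.
          arc (\<gamma> e) \<and> {pathstart (\<gamma> e), pathfinish (\<gamma> e)} = p ` e \<and>
          path_image (\<gamma> e) \<inter> p ` V = p ` e) \<and>
       (\<forall>e\<in>graph_edges V E. \<forall>f\<in>graph_edges V E. e \<noteq> f \<longrightarrow>
          path_image (\<gamma> e) \<inter> path_image (\<gamma> f) \<subseteq> p ` (e \<inter> f)))"

(* A move of the cops (positions given as a list, one entry per cop): every cop stays
   or moves to an adjacent vertex, and at most k cops change their position. *)
definition cop_move :: "('a \<Rightarrow> 'a \<Rightarrow> bool) \<Rightarrow> nat \<Rightarrow> 'a list \<Rightarrow> 'a list \<Rightarrow> bool" where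
  "cop_move E k cs cs' \<longleftrightarrow> length cs' = length cs \<and>
     (\<forall>i<length cs. cs' ! i = cs ! i \<or> E (cs ! i) (cs' ! i)) \<and>
     card {i. i < length cs \<and> cs' ! i \<noteq> cs ! i} \<le> k"

(* Winning region of the cops (positions from which the cops can force capture):
   cop_win_C: cops to move; cop_win_R: robber to move. *)
inductive cop_win_C :: "'a set \<Rightarrow> ('a \<Rightarrow> 'a \<Rightarrow> bool) \<Rightarrow> nat \<Rightarrow> 'a list \<Rightarrow> 'a \<Rightarrow> bool"
  and cop_win_R :: "'a set \<Rightarrow> ('a \<Rightarrow> 'a \<Rightarrow> bool) \<Rightarrow> nat \<Rightarrow> 'a list \<Rightarrow> 'a \<Rightarrow> bool"
  for V E k where
  capC: "r \<in> set cs \<Longrightarrow> cop_win_C V E k cs r"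
| moveC: "cop_move E k cs cs' \<Longrightarrow> cop_win_R V E k cs' r \<Longrightarrow> cop_win_C V E k cs r"
| capR: "r \<in> set cs \<Longrightarrow> cop_win_R V E k cs r"
| moveR: "(\<And>r'. r' \<in> V \<Longrightarrow> r' = r \<or> E r r' \<Longrightarrow> cop_win_C V E k cs r') \<Longrightarrow>
          cop_win_R V E k cs r"

(* t cops can guarantee capture when at most k cops move per turn: the cops place
   themselves, then the robber places himself, then the cops move first. *)
definition cops_win :: "'a set \<Rightarrow> ('a \<Rightarrow> 'a \<Rightarrow> bool) \<Rightarrow> nat \<Rightarrow> nat \<Rightarrow> bool" where
  "cops_win V E k t \<longleftrightarrow>
     (\<exists>cs. length cs = t \<and> set cs \<subseteq> V \<and> (\<forall>r\<in>V. cop_win_C V E k cs r))"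

definition cop_number_k :: "nat \<Rightarrow> 'a set \<Rightarrow> ('a \<Rightarrow> 'a \<Rightarrow> bool) \<Rightarrow> nat" where
  "cop_number_k k V E = (LEAST t. cops_win V E k t)"

end

theory Submission
  imports Defs "HOL-Library.Sublist"
begin

text \<open>
  As in the theorem of Aigner and Fromme, the robber is confined to a connected territory whose
  boundary lies on two guarded paths forming a cycle, and the third cop shrinks the territory by
  occupying a further path through it.  A path that is geodesic with respect to walks through the
  territory is guarded by a cop who stays in the interval of positions from which every vertex of the
  path can be reached in time; he has to move at most one step per round.  Since only two cops may
  move, the third one is blocked in the rounds in which both guards are forced to move.  This cannot go
  on forever if one of the two paths is a strict geodesic, that is, if every walk through the
  territory is longer than the corresponding part of the path: then the interval always has two
  positions, so that consecutive forced moves all have the same direction.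

  It remains to choose the new path such that one of the two paths bounding the new territory is again
  strict.  It replaces a segment of one of the two old paths by a detour through the territory with
  the least excess length, then the shortest segment, then the smallest region between segment and
  detour.  If the robber ends up between the two, a walk through his territory showing that the
  segment is not strict would be a detour enclosing a smaller region.  Two consequences of the
  Jordan curve theorem for theta curves enter here, which amount to the nonplanarity of
  $K_{3,3}$ and $K_5$.
\<close>

text \<open>Walks may end on the boundary but otherwise stay in the territory, so distances can only
  grow when the territory shrinks. A guard of a path is therefore at once a guard of each of its
  segments against each smaller territory, and passing to a new pair of paths costs no move. The
  detour is taken along the path whose strictness is not relied upon. If the robber does not end up
  between segment and detour, the other path is still strict. Otherwise the segment has to be
  strict, and the three criteria serve this in turn. Least excess makes the old path with the detour
  inserted a geodesic. A walk violating strictness of the segment yields a detour of excess zero, so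
  the least excess is zero as well, and the shortest segment forces this walk to join the two ends
  of the segment. Only then can the enclosed regions be compared. A path with at most one vertex
  that has neighbours in the territory is strict for free; this supplies strictness at the start and
  where the two paths exchange their roles.\<close>

subsection \<open>Theta curves\<close>

text \<open>The arc \<open>c\<close> cuts the inside of the closed curve into two regions, and the
  connected set \<open>S\<close> lies in one of them. The closure of that region adds only its own
  boundary, which contains just one of \<open>c1\<close> and \<open>c2\<close>; so \<open>S\<close>
  cannot accumulate at inner points of both.\<close>

lemma theta_inside:
  fixes c :: "real \<Rightarrow> complex"
  assumes "arc c1" and c1: "pathstart c1 = a" "pathfinish c1 = b"
      and "arc c2" and c2: "pathstart c2 = a" "pathfinish c2 = b"
      and "arc c" and c: "pathstart c = a" "pathfinish c = b"
      and c1c2: "path_image c1 \<inter> path_image c2 = {a,b}"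
      and c1c: "path_image c1 \<inter> path_image c = {a,b}"
      and c2c: "path_image c2 \<inter> path_image c = {a,b}"
      and S: "connected S" "S \<inter> (path_image c1 \<union> path_image c2 \<union> path_image c) = {}"
      and p: "p \<in> closure S" "p \<in> path_image c1 - {a,b}"
      and q: "q \<in> closure S" "q \<in> path_image c2 - {a,b}"
      and ins: "S \<subseteq> inside (path_image c1 \<union> path_image c2)"
      and insc: "path_image c - {a,b} \<subseteq> inside (path_image c1 \<union> path_image c2)"
    shows False
proof -
  have "a \<noteq> b"
    using \<open>arc c1\<close> c1 arc_distinct_ends by blast
  have sp: "simple_path c1" "simple_path c2" "simple_path c"
    using assms arc_imp_simple_path by auto
  have "path_image c - {a,b} \<noteq> {}"
    using simple_path_endless[OF sp(3)] c by (metis nonempty_simple_path_endless sp(3))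
  then have "path_image c \<inter> inside (path_image c1 \<union> path_image c2) \<noteq> {}"
    using insc by blast
  from split_inside_simple_closed_curve[OF sp(1) c1 sp(2) c2 sp(3) c \<open>a \<noteq> b\<close> c1c2 c1c c2c this]
  have d: "inside (path_image c1 \<union> path_image c) \<inter> inside (path_image c2 \<union> path_image c) = {}"
    and u: "inside (path_image c1 \<union> path_image c) \<union> inside (path_image c2 \<union> path_image c) \<union>
           (path_image c - {a,b}) = inside (path_image c1 \<union> path_image c2)"
    by blast+
  \<comment> \<open>The two regions are treated alike. Here \<open>c1\<close>, \<open>c2\<close> and
    \<open>q\<close> are rebound: \<open>S\<close> lies between \<open>c1\<close> and
    \<open>c\<close>, and \<open>q\<close> is on the opposite arc \<open>c2\<close>.\<close>
  have *: "q \<notin> closure S" if "arc c1" "pathstart c1 = a" "pathfinish c1 = b" "path_image c1 \<inter> path_image c = {a,b}"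
     "S \<subseteq> inside (path_image c1 \<union> path_image c)" "q \<in> path_image c2 - {a,b}" "path_image c2 \<inter> path_image c = {a,b}"
     "path_image c1 \<inter> path_image c2 = {a,b}" "inside (path_image c1 \<union> path_image c) \<subseteq> inside (path_image c1 \<union> path_image c2)"
   for c1 c2 q
  proof
    assume "q \<in> closure S"
    let ?g = "c1 +++ reversepath c"
    have "simple_path ?g" using that \<open>arc c\<close> c
      by (auto simp: simple_path_join_loop_eq arc_simple_path simple_path_reversepath)
    moreover have "pathfinish ?g = pathstart ?g" using that c by simp
    moreover have im: "path_image ?g = path_image c1 \<union> path_image c"
      using that c by (simp add: path_image_join)
    ultimately have "frontier (inside (path_image c1 \<union> path_image c)) = path_image c1 \<union> path_image c"
      using Jordan_inside_outside[of ?g] by simp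
    then have "closure (inside (path_image c1 \<union> path_image c)) \<subseteq> inside (path_image c1 \<union> path_image c) \<union> (path_image c1 \<union> path_image c)"
      by (simp add: closure_Un_frontier)
    with \<open>q \<in> closure S\<close> that have "q \<in> inside (path_image c1 \<union> path_image c) \<union> (path_image c1 \<union> path_image c)"
      by (meson closure_mono subsetD)
    moreover have "q \<notin> inside (path_image c1 \<union> path_image c2)"
      using that by (metis DiffD1 IntI UnI2 empty_iff inside_no_overlap)
    ultimately show False using that by blast
  qed
  have op: "open (inside (path_image c1 \<union> path_image c))" "open (inside (path_image c2 \<union> path_image c))"
    using sp by (auto intro!: open_inside closed_Un closed_simple_path_image)
  have "S \<subseteq> inside (path_image c1 \<union> path_image c) \<union> inside (path_image c2 \<union> path_image c)"
    using u ins S by blast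
  then consider "S \<subseteq> inside (path_image c1 \<union> path_image c)" | "S \<subseteq> inside (path_image c2 \<union> path_image c)"
    using connectedD[OF S(1) op] d by blast
  then show False
  proof cases
    case 1
    moreover have "inside (path_image c1 \<union> path_image c) \<subseteq> inside (path_image c1 \<union> path_image c2)"
      using u by blast
    ultimately show False using *[of c1 q c2] assms by blast
  next
    case 2
    have "inside (path_image c2 \<union> path_image c) \<subseteq> inside (path_image c2 \<union> path_image c1)"
      using u by (auto simp: Un_commute)
    moreover have "path_image c2 \<inter> path_image c1 = {a, b}" using c1c2 by blast
    ultimately show False using *[of c2 p c1] 2 assms by blast
  qed
qed

text \<open>The punctured inside is sent to an unbounded connected set off the new curve, hence into
  the new outside. The new inside is nonempty, so it is met by the image of the old outside, and
  connectedness puts this whole image inside.\<close>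

lemma inversion_outside:
  fixes g :: "real \<Rightarrow> complex" and z0 :: complex
  assumes "simple_path g" "pathfinish g = pathstart g" and z0: "z0 \<in> inside (path_image g)"
  defines "h \<equiv> \<lambda>z. inverse (z - z0)"
  shows "h ` outside (path_image g) \<subseteq> inside (path_image (h \<circ> g))"
proof -
  let ?J = "path_image g"
  have J: "inside ?J \<noteq> {}" "open (inside ?J)" "connected (inside ?J)" "connected (outside ?J)"
      "inside ?J \<inter> outside ?J = {}" "inside ?J \<union> outside ?J = - ?J"
    using Jordan_inside_outside[OF assms(1,2)] by auto
  have z0J: "z0 \<notin> ?J" "z0 \<notin> outside ?J"
    using z0 J by blast+
  have cont: "continuous_on (- {z0}) h"
    unfolding h_def by (intro continuous_intros) auto
  \<comment> \<open>Since \<open>inverse 0 = 0\<close>, the map is injective on the whole plane and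
    sends \<open>z0\<close> to 0.\<close>
  have inj: "inj h"
    unfolding h_def by (auto simp: inj_on_def)
  have "simple_path (h \<circ> g)"
  proof (rule simple_path_continuous_image)
    show "continuous_on (path_image g) h"
      using cont by (rule continuous_on_subset) (use z0J in auto)
  qed (use assms inj in \<open>auto intro: inj_on_subset\<close>)
  moreover have "pathfinish (h \<circ> g) = pathstart (h \<circ> g)"
    using assms by (simp add: pathfinish_compose pathstart_compose)
  ultimately have J': "inside (path_image (h \<circ> g)) \<noteq> {}" "open (inside (path_image (h \<circ> g)))"
      "inside (path_image (h \<circ> g)) \<union> outside (path_image (h \<circ> g)) = - path_image (h \<circ> g)"
      "inside (path_image (h \<circ> g)) \<inter> outside (path_image (h \<circ> g)) = {}"
      "open (outside (path_image (h \<circ> g)))" "bounded (inside (path_image (h \<circ> g)))"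
    using Jordan_inside_outside[of "h \<circ> g"] by auto
  have imJ: "path_image (h \<circ> g) = h ` ?J"
    by (simp add: path_image_compose)
  have punct: "h ` (inside ?J - {z0}) \<subseteq> outside (path_image (h \<circ> g))"
  proof -
    let ?A = "h ` (inside ?J - {z0})"
    have con: "connected ?A"
    proof (rule connected_continuous_image)
      show "connected (inside ?J - {z0})"
        using J by (intro connected_open_delete) auto
      show "continuous_on (inside ?J - {z0}) h"
        using cont by (rule continuous_on_subset) auto
    qed
    have dis: "?A \<inter> path_image (h \<circ> g) = {}"
      unfolding imJ using injD[OF inj] J by blast
    have "\<not> bounded ?A"
    proof
      assume "bounded ?A"
      then obtain B where B: "B > 0" "\<And>x. x \<in> ?A \<Longrightarrow> norm x \<le> B"
        unfolding bounded_pos by auto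
      obtain e where e: "e > 0" "ball z0 e \<subseteq> inside ?J"
        using J z0 openE by blast
      \<comment> \<open>At distance \<open>t < e\<close> from \<open>z0\<close> one is still inside
        the curve, while the image has norm \<open>1/t\<close>, which exceeds
        \<open>B\<close>.\<close>
      define t where "t = min (e/2) (1/(2*B))"
      have t: "t > 0" "t < e" "t * B < 1"
        using e B by (auto simp: t_def min_def field_simps)
      have "z0 + of_real t \<in> inside ?J - {z0}"
        using e t by (auto simp: subset_iff dist_norm)
      then have "h (z0 + of_real t) \<in> ?A" by (rule imageI)
      then have "norm (h (z0 + of_real t)) \<le> B" by (rule B)
      moreover have "norm (h (z0 + of_real t)) = inverse t"
        using t by (simp add: h_def norm_inverse)
      ultimately have "1 \<le> t * B"
        using t by (simp add: inverse_eq_divide divide_le_eq mult.commute)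
      then show False using t by simp
    qed
    then have "\<not> ?A \<subseteq> inside (path_image (h \<circ> g))"
      using J' bounded_subset by blast
    moreover have "?A \<subseteq> inside (path_image (h \<circ> g)) \<union> outside (path_image (h \<circ> g))"
      using dis J' by blast
    ultimately show ?thesis
      using connectedD[OF con J'(2) J'(5)] J' by blast
  qed
  have un: "UNIV = h ` (inside ?J - {z0}) \<union> h ` outside ?J \<union> h ` ?J \<union> {0}"
  proof -
    have "w \<in> h ` (inside ?J - {z0}) \<union> h ` outside ?J \<union> h ` ?J" if "w \<noteq> 0" for w
    proof -
      have "w = h (z0 + inverse w)" by (simp add: h_def)
      moreover have "z0 + inverse w \<noteq> z0" using that by simp
      ultimately show ?thesis using J(6) by blast
    qed
    then show ?thesis by auto
  qed
  \<comment> \<open>The point 0 is the image of \<open>z0\<close> alone, but a nonempty open set has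
    further points.\<close>
  obtain w where w: "w \<in> inside (path_image (h \<circ> g))" "w \<noteq> 0"
  proof -
    have "\<not> inside (path_image (h \<circ> g)) \<subseteq> {0}"
      using J' not_open_singleton by (metis subset_singletonD)
    then show ?thesis using that by blast
  qed
  have "w \<notin> h ` ?J"
    using w(1) J'(3) imJ by (metis ComplD UnI1)
  moreover have "w \<notin> h ` (inside ?J - {z0})"
    using w(1) J'(4) punct by (metis IntI empty_iff subsetD)
  moreover have "w \<in> h ` (inside ?J - {z0}) \<union> h ` outside ?J \<union> h ` ?J \<union> {0}"
    using un by (metis UNIV_I)
  ultimately have "w \<in> h ` outside ?J"
    using w(2) by simp
  moreover have "connected (h ` outside ?J)"
    by (rule connected_continuous_image[OF continuous_on_subset[OF cont]]) (use J z0J in auto)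
  moreover have "h ` outside ?J \<inter> path_image (h \<circ> g) = {}"
    unfolding imJ using injD[OF inj] J by blast
  moreover have "h ` outside ?J \<inter> inside (path_image (h \<circ> g)) \<noteq> {}"
    using w \<open>w \<in> h ` outside ?J\<close> by blast
  moreover have "h ` outside ?J \<subseteq> inside (path_image (h \<circ> g)) \<union> outside (path_image (h \<circ> g))"
    unfolding J'(3) using \<open>h ` outside ?J \<inter> path_image (h \<circ> g) = {}\<close> by blast
  moreover have "inside (path_image (h \<circ> g)) \<inter> outside (path_image (h \<circ> g)) \<inter> h ` outside ?J = {}"
    unfolding J'(4) by simp
  ultimately have "outside (path_image (h \<circ> g)) \<inter> h ` outside ?J = {}"
    using connectedD[OF _ J'(2) J'(5)] by (metis Int_commute)
  with \<open>h ` outside ?J \<subseteq> _\<close> show ?thesis by blast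
qed

text \<open>Inversion at a point inside the closed curve reduces this to
  \<open>theta_inside\<close>.\<close>

lemma theta_outside:
  fixes c :: "real \<Rightarrow> complex"
  assumes "arc c1" and c1: "pathstart c1 = a" "pathfinish c1 = b"
      and "arc c2" and c2: "pathstart c2 = a" "pathfinish c2 = b"
      and "arc c" and c: "pathstart c = a" "pathfinish c = b"
      and c1c2: "path_image c1 \<inter> path_image c2 = {a,b}"
      and c1c: "path_image c1 \<inter> path_image c = {a,b}"
      and c2c: "path_image c2 \<inter> path_image c = {a,b}"
      and S: "connected S" "S \<inter> (path_image c1 \<union> path_image c2 \<union> path_image c) = {}"
      and p: "p \<in> closure S" "p \<in> path_image c1 - {a,b}"
      and q: "q \<in> closure S" "q \<in> path_image c2 - {a,b}"
      and out: "S \<subseteq> outside (path_image c1 \<union> path_image c2)"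
      and outc: "path_image c - {a,b} \<subseteq> outside (path_image c1 \<union> path_image c2)"
    shows False
proof -
  let ?g = "c1 +++ reversepath c2"
  have g: "simple_path ?g" "pathfinish ?g = pathstart ?g" "path_image ?g = path_image c1 \<union> path_image c2"
    using \<open>arc c1\<close> \<open>arc c2\<close> c1 c2 c1c2
    by (auto simp: simple_path_join_loop_eq arc_simple_path simple_path_reversepath path_image_join)
  have J: "open (inside (path_image c1 \<union> path_image c2))"
    and Jio: "inside (path_image c1 \<union> path_image c2) \<inter> outside (path_image c1 \<union> path_image c2) = {}"
    and Jne: "inside (path_image c1 \<union> path_image c2) \<noteq> {}"
    using Jordan_inside_outside[OF g(1,2)] g(3) by auto
  from Jne obtain z0 where z0: "z0 \<in> inside (path_image c1 \<union> path_image c2)" by blast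
  define h where "h \<equiv> \<lambda>z. inverse (z - z0)"
  have h: "h ` outside (path_image c1 \<union> path_image c2) \<subseteq> inside (h ` (path_image c1 \<union> path_image c2))"
    using inversion_outside[OF g(1,2), of z0] z0 g(3) by (simp add: h_def path_image_compose)
  have cont: "continuous_on (- {z0}) h"
    unfolding h_def by (intro continuous_intros) auto
  have inj: "inj h"
    unfolding h_def by (auto simp: inj_on_def)
  have z0J: "z0 \<notin> path_image c1" "z0 \<notin> path_image c2"
    using z0 by (metis IntI Un_iff empty_iff inside_no_overlap)+
  have "z0 \<notin> outside (path_image c1 \<union> path_image c2)"
    using z0 Jio by blast
  then have z0c: "z0 \<notin> path_image c"
    using outc c1c z0J by blast
  \<comment> \<open>The inversion is continuous only away from \<open>z0\<close>, so limit points of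
    \<open>S\<close> carry over only if \<open>z0\<close> is not one of them.\<close>
  have z0S: "z0 \<notin> closure S"
  proof -
    have "inside (path_image c1 \<union> path_image c2) \<inter> S = {}" using Jio out by blast
    then show ?thesis using z0 open_Int_closure_eq_empty[OF J, of S] by blast
  qed
  have arc: "arc (h \<circ> k)" if "arc k" "z0 \<notin> path_image k" for k
  proof -
    have "path (h \<circ> k)"
      using that arc_imp_path by (intro path_continuous_image continuous_on_subset[OF cont]) auto
    moreover have "inj_on (h \<circ> k) {0..1}"
      using \<open>arc k\<close> inj by (auto simp: arc_def intro: comp_inj_on inj_on_subset)
    ultimately show ?thesis by (simp add: arc_def)
  qed
  have clo: "h x \<in> closure (h ` S)" if "x \<in> closure S" for x
  proof -
    have "h ` closure S \<subseteq> closure (h ` S)"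
    proof (rule image_closure_subset)
      show "continuous_on (closure S) h" by (rule continuous_on_subset[OF cont]) (use z0S in auto)
    qed (simp_all add: closure_subset)
    then show ?thesis using that by blast
  qed
  have im: "path_image (h \<circ> k) = h ` path_image k" for k
    by (simp add: path_image_compose)
  have int: "h ` X \<inter> h ` Y = h ` (X \<inter> Y)" for X Y
    using image_Int[OF inj] by simp
  have dif: "h ` X - {h a, h b} = h ` (X - {a, b})" for X
    using image_set_diff[OF inj, of X "{a,b}"] by simp
  show False
  proof (rule theta_inside[of "h \<circ> c1" "h a" "h b" "h \<circ> c2" "h \<circ> c" "h ` S" "h p" "h q"])
    show "connected (h ` S)"
      by (rule connected_continuous_image[OF continuous_on_subset[OF cont] S(1)])
         (use z0S closure_subset in auto)
    show "h ` S \<inter> (path_image (h \<circ> c1) \<union> path_image (h \<circ> c2) \<union> path_image (h \<circ> c)) = {}"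
      using S(2) by (simp add: im int flip: image_Un)
    show "h ` S \<subseteq> inside (path_image (h \<circ> c1) \<union> path_image (h \<circ> c2))"
      unfolding im image_Un[symmetric] using h image_mono[OF out, of h] by (rule subset_trans[rotated])
    show "path_image (h \<circ> c) - {h a, h b} \<subseteq> inside (path_image (h \<circ> c1) \<union> path_image (h \<circ> c2))"
      unfolding im dif image_Un[symmetric] using h outc by blast
    show "h p \<in> path_image (h \<circ> c1) - {h a, h b}" "h q \<in> path_image (h \<circ> c2) - {h a, h b}"
      unfolding im dif using p q by blast+
    show "path_image (h \<circ> c1) \<inter> path_image (h \<circ> c2) = {h a, h b}"
      "path_image (h \<circ> c1) \<inter> path_image (h \<circ> c) = {h a, h b}"
      "path_image (h \<circ> c2) \<inter> path_image (h \<circ> c) = {h a, h b}"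
      unfolding im int c1c2 c1c c2c by simp_all
    show "arc (h \<circ> c1)" "arc (h \<circ> c2)" "arc (h \<circ> c)"
      using arc assms z0J z0c by blast+
  qed (use c1 c2 c p q clo in \<open>simp_all add: pathstart_compose pathfinish_compose\<close>)
qed

subsection \<open>Paths in a plane drawing\<close>

fun pedges :: "'a list \<Rightarrow> 'a set set" where
  "pedges (a # b # xs) = insert {a, b} (pedges (b # xs))"
| "pedges _ = {}"

lemma finite_pedges [simp]: "finite (pedges ps)"
  by (induction ps rule: pedges.induct) auto

lemma Union_pedges: "length ps \<ge> 2 \<Longrightarrow> \<Union> (pedges ps) = set ps"
proof (induction ps rule: pedges.induct)
  case (1 a b xs)
  then show ?case by (cases xs) auto
qed auto

lemma pedges_subset: "e \<in> pedges ps \<Longrightarrow> e \<subseteq> set ps"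
  by (induction ps rule: pedges.induct) auto

lemma pedges_inner: "e \<in> pedges (a # ws @ [b]) \<Longrightarrow> e = {a, b} \<or> (\<exists>w\<in>set ws. w \<in> e)"
  by (induction ws arbitrary: a) auto

text \<open>Two paths with the same ends could share the edge between these ends. As soon as one of
  them has an inner vertex this is impossible, and then paths that meet only in their ends have no
  common edge.\<close>

lemma hd_last_notin_pedges:
  assumes "distinct ps" "c \<in> set ps" "c \<noteq> hd ps" "c \<noteq> last ps"
  shows "{hd ps, last ps} \<notin> pedges ps"
proof
  assume *: "{hd ps, last ps} \<in> pedges ps"
  then obtain a b xs where ps: "ps = a # b # xs"
    by (metis empty_iff pedges.elims)
  then have "xs \<noteq> []" using assms by auto
  then have "last ps \<noteq> b" "hd ps = a" using assms(1) ps by auto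
  then have "{a, last ps} \<in> pedges (b # xs)"
    using * ps by (auto simp: doubleton_eq_iff)
  then have "a \<in> set (b # xs)"
    using pedges_subset by fastforce
  then show False using assms(1) ps by simp
qed

lemma pedges_graph: "\<lbrakk>simple_graph V E; successively E ps\<rbrakk> \<Longrightarrow> pedges ps \<subseteq> graph_edges V E"
proof (induction ps rule: pedges.induct)
  case (1 a b xs)
  then have "{a, b} \<in> graph_edges V E"
    unfolding graph_edges_def simple_graph_def successively.simps by blast
  then show ?case using 1 by simp
qed auto

section \<open>Edge arcs of a plane drawing and the sides of a cycle\<close>

locale drawing =
  fixes V :: "'a set" and E :: "'a \<Rightarrow> 'a \<Rightarrow> bool"
    and p :: "'a \<Rightarrow> complex" and \<gamma> :: "'a set \<Rightarrow> real \<Rightarrow> complex"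
  assumes sg: "simple_graph V E"
    and inj_p: "inj_on p V"
    and arc_edge: "e \<in> graph_edges V E \<Longrightarrow> arc (\<gamma> e)"
    and ends_edge: "e \<in> graph_edges V E \<Longrightarrow> {pathstart (\<gamma> e), pathfinish (\<gamma> e)} = p ` e"
    and vertices_edge: "e \<in> graph_edges V E \<Longrightarrow> path_image (\<gamma> e) \<inter> p ` V = p ` e"
    and edges_meet: "\<lbrakk>e \<in> graph_edges V E; f \<in> graph_edges V E; e \<noteq> f\<rbrakk> \<Longrightarrow>
          path_image (\<gamma> e) \<inter> path_image (\<gamma> f) \<subseteq> p ` (e \<inter> f)"
begin

lemma edgeI: "E u v \<Longrightarrow> {u, v} \<in> graph_edges V E"
  using sg by (auto simp: graph_edges_def simple_graph_def)

lemma edge_sub: "e \<in> graph_edges V E \<Longrightarrow> e \<subseteq> V"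
  by (auto simp: graph_edges_def)

definition drawn :: "'a set set \<Rightarrow> complex set" where
  "drawn F = (\<Union>e\<in>F. path_image (\<gamma> e))"

text \<open>Without its end points an edge arc is disjoint from all vertices and all other edges, so
  it can lie entirely on one side of a closed curve that passes through its ends.\<close>

definition oarc :: "'a set \<Rightarrow> complex set" where
  "oarc e = path_image (\<gamma> e) - p ` e"

lemma closed_drawn: "F \<subseteq> graph_edges V E \<Longrightarrow> finite F \<Longrightarrow> closed (drawn F)"
  unfolding drawn_def using arc_edge by (intro closed_UN) (auto intro: closed_arc_image)

lemma connected_oarc: "e \<in> graph_edges V E \<Longrightarrow> connected (oarc e)"
  unfolding oarc_def using ends_edge[of e] arc_edge[of e] connected_simple_path_endless[of "\<gamma> e"]
  by (simp add: arc_imp_simple_path)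

lemma oarc_nonempty: "e \<in> graph_edges V E \<Longrightarrow> oarc e \<noteq> {}"
  unfolding oarc_def using ends_edge[of e] arc_edge[of e] nonempty_simple_path_endless[of "\<gamma> e"]
  by (simp add: arc_imp_simple_path)

lemma oarc_closure:
  assumes "e \<in> graph_edges V E" "v \<in> e"
  shows "p v \<in> closure (oarc e)"
proof -
  have "{0<..<1::real} \<subseteq> {0..1}" by auto
  have "\<gamma> e ` {0<..<1} \<subseteq> oarc e"
  proof
    fix z assume "z \<in> \<gamma> e ` {0<..<1}"
    then obtain t where t: "z = \<gamma> e t" "0 < t" "t < 1" by auto
    have "inj_on (\<gamma> e) {0..1}" using arc_edge[OF assms(1)] by (simp add: arc_def)
    then have "\<gamma> e t \<noteq> \<gamma> e 0" "\<gamma> e t \<noteq> \<gamma> e 1"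
      using t inj_onD[of "\<gamma> e" "{0..1}" t 0] inj_onD[of "\<gamma> e" "{0..1}" t 1] by auto
    then show "z \<in> oarc e"
      using t ends_edge[OF assms(1)] unfolding oarc_def path_image_def pathstart_def pathfinish_def by force
  qed
  moreover have "\<gamma> e ` closure {0<..<1} \<subseteq> closure (\<gamma> e ` {0<..<1})"
    using arc_edge[OF assms(1)]
    by (intro image_closure_subset) (auto simp: arc_def path_def intro: closure_subset[THEN subsetD])
  ultimately have "path_image (\<gamma> e) \<subseteq> closure (oarc e)"
    unfolding path_image_def by (simp add: closure_greaterThanLessThan) (meson closure_mono order_trans)
  then show ?thesis using vertices_edge[OF assms(1)] assms(2) by blast
qed

lemma oarc_vertex: "e \<in> graph_edges V E \<Longrightarrow> v \<in> V \<Longrightarrow> p v \<notin> oarc e"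
  unfolding oarc_def using vertices_edge by blast

lemma oarc_drawn: "\<lbrakk>e \<in> graph_edges V E; F \<subseteq> graph_edges V E; e \<notin> F\<rbrakk> \<Longrightarrow> oarc e \<inter> drawn F = {}"
  unfolding oarc_def drawn_def using edges_meet by blast

lemma vertex_drawn: "\<lbrakk>F \<subseteq> graph_edges V E; v \<in> V; v \<notin> \<Union> F\<rbrakk> \<Longrightarrow> p v \<notin> drawn F"
proof
  assume F: "F \<subseteq> graph_edges V E" "v \<in> V" "v \<notin> \<Union> F" and "p v \<in> drawn F"
  then obtain e where e: "e \<in> F" "p v \<in> path_image (\<gamma> e)" unfolding drawn_def by blast
  then have eg: "e \<in> graph_edges V E" using F(1) by blast
  have "p v \<in> p ` e" using vertices_edge[OF eg] e(2) F(2) by blast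
  then obtain w where w: "w \<in> e" "p v = p w" by blast
  then have "v = w" using inj_onD[OF inj_p, of v w] edge_sub[OF eg] F(2) by blast
  then show False using w(1) e(1) F(3) by blast
qed

lemma drawn_Int:
  assumes "F \<subseteq> graph_edges V E" "G \<subseteq> graph_edges V E" "F \<inter> G = {}"
  shows "drawn F \<inter> drawn G \<subseteq> p ` (\<Union> F \<inter> \<Union> G)"
  unfolding drawn_def using assms edges_meet by blast

lemma oarc_vertex_connected:
  assumes "E v a" "E v b"
  shows "connected (oarc {v,a} \<union> {p v} \<union> oarc {v,b})"
proof -
  have c: "connected (oarc {v,x} \<union> {p v})" if "E v x" for x
    using that by (intro connected_intermediate_closure[OF connected_oarc[OF edgeI[OF that]]])
      (auto intro: oarc_closure edgeI closure_subset[THEN subsetD])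
  have "connected ((oarc {v,a} \<union> {p v}) \<union> (oarc {v,b} \<union> {p v}))"
    by (rule connected_Un) (use c assms in auto)
  then show ?thesis by (simp add: Un_ac)
qed

text \<open>Every inner vertex is a limit point of the open arcs at it and glues consecutive arcs
  together. The two ends of the walk are left out because they will lie on the closed curve that the
  walk has to avoid.\<close>

lemma walk_connected:
  "successively E (a # ws @ [b]) \<Longrightarrow> connected (\<Union> (oarc ` pedges (a # ws @ [b])) \<union> p ` set ws)"
proof (induction ws arbitrary: a)
  case Nil
  then show ?case by (auto intro!: connected_oarc edgeI)
next
  case (Cons w ws)
  let ?c = "hd (ws @ [b])"
  have E: "E w a" "E w ?c" "successively E (w # ws @ [b])"
    using Cons.prems sg by (auto simp: successively_Cons simple_graph_def)
  have in_ped: "{w, ?c} \<in> pedges (w # ws @ [b])" by (cases ws) auto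
  let ?T = "\<Union> (oarc ` pedges (w # ws @ [b])) \<union> p ` set ws"
  have "connected ((oarc {w,a} \<union> {p w} \<union> oarc {w,?c}) \<union> ?T)"
  proof (rule connected_Un)
    show "(oarc {w, a} \<union> {p w} \<union> oarc {w, ?c}) \<inter> ?T \<noteq> {}"
      using in_ped oarc_nonempty[OF edgeI[OF E(2)]] by blast
  qed (use oarc_vertex_connected Cons.IH E in auto)
  moreover have "(oarc {w,a} \<union> {p w} \<union> oarc {w,?c}) \<union> ?T
     = \<Union> (oarc ` pedges (a # (w # ws) @ [b])) \<union> p ` set (w # ws)"
    using in_ped by (auto simp: insert_commute)
  ultimately show ?case by simp
qed

lemma path_arc:
  assumes "successively E ps" "distinct ps" "length ps \<ge> 2"
  shows "\<exists>g. arc g \<and> pathstart g = p (hd ps) \<and> pathfinish g = p (last ps) \<and> path_image g = drawn (pedges ps)"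
  using assms
proof (induction ps rule: pedges.induct)
  case (1 a b xs)
  have ab: "E a b" "a \<noteq> b" using 1 by auto
  then have e: "{a,b} \<in> graph_edges V E" by (intro edgeI)
  have V: "a \<in> V" "b \<in> V" using e edge_sub by auto
  have "\<exists>g. arc g \<and> pathstart g = p a \<and> pathfinish g = p b \<and> path_image g = path_image (\<gamma> {a,b})"
  proof (cases "pathstart (\<gamma> {a,b}) = p a")
    case True
    moreover have "p a \<noteq> p b" using inj_p V ab by (auto simp: inj_on_def)
    ultimately show ?thesis using ends_edge[OF e] arc_edge[OF e] by (auto simp: doubleton_eq_iff)
  next
    case False
    then show ?thesis using ends_edge[OF e] arc_edge[OF e]
      by (intro exI[of _ "reversepath (\<gamma> {a,b})"]) (auto simp: doubleton_eq_iff arc_reversepath)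
  qed
  then obtain g where g: "arc g" "pathstart g = p a" "pathfinish g = p b" "path_image g = path_image (\<gamma> {a,b})"
    by blast
  show ?case
  proof (cases xs)
    case Nil
    then show ?thesis using g by (auto simp: drawn_def)
  next
    case (Cons c ys)
    then obtain k where k: "arc k" "pathstart k = p b" "pathfinish k = p (last (b # xs))"
        "path_image k = drawn (pedges (b # xs))"
      using 1 by auto
    have sub: "pedges (b # xs) \<subseteq> graph_edges V E"
      using 1 pedges_graph[OF sg] by auto
    have "path_image g \<inter> path_image k \<subseteq> {p b}"
    proof -
      have "{a,b} \<notin> pedges (b # xs)" using 1 pedges_subset by fastforce
      then have "drawn {{a,b}} \<inter> drawn (pedges (b # xs)) \<subseteq> p ` (\<Union> {{a,b}} \<inter> \<Union> (pedges (b # xs)))"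
        using e sub by (intro drawn_Int) auto
      moreover have "a \<notin> \<Union> (pedges (b # xs))" using 1 pedges_subset by fastforce
      ultimately show ?thesis unfolding g(4) k(4) by (auto simp: drawn_def)
    qed
    then have "arc (g +++ k)" using g k by (intro arc_join) auto
    moreover have "path_image (g +++ k) = drawn (pedges (a # b # xs))"
      using g k by (simp add: path_image_join drawn_def)
    ultimately show ?thesis using g k
      by (intro exI[of _ "g +++ k"]) auto
  qed
qed auto

lemma edge_eq_pair:
  assumes "e \<in> graph_edges V E" "e \<subseteq> {x, y}"
  shows "e = {x, y}"
  using assms sg by (auto simp: graph_edges_def simple_graph_def)

text \<open>The facts about the plane on which all later planarity arguments rest:
  \<open>side\<close> tells whether an edge runs inside the cycle formed by \<open>A\<close> and
  \<open>B\<close>. It is a property of edges, not of vertices, so that a single edge from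
  \<open>A\<close> to \<open>B\<close> has a side, too. If the connecting walk and the third path
  \<open>C\<close> were on the same side, they would contradict \<open>theta_inside\<close> or
  \<open>theta_outside\<close>. The walk may repeat vertices.\<close>

lemma sides:
  assumes A: "successively E A" "distinct A" "hd A = x" "last A = y"
    and B: "successively E B" "distinct B" "hd B = x" "last B = y"
    and AB: "set A \<inter> set B = {x, y}" and xy: "x \<noteq> y"
  obtains side :: "'a set \<Rightarrow> bool" where
    "\<And>v a b. \<lbrakk>v \<notin> set A \<union> set B; E v a; E v b\<rbrakk> \<Longrightarrow> side {v, a} = side {v, b}"
    "\<And>C a ws b. \<lbrakk>successively E C; distinct C; hd C = x; last C = y;
        set C \<inter> (set A \<union> set B) = {x, y}; successively E (a # ws @ [b]);
        a \<in> set A - {x, y}; b \<in> set B - {x, y}; set ws \<inter> (set A \<union> set B \<union> set C) = {}\<rbrakk>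
      \<Longrightarrow> side {a, hd (ws @ [b])} \<noteq> side {x, hd (tl C)}"
proof -
  define J where "J = drawn (pedges A \<union> pedges B)"
  define side where "side e \<longleftrightarrow> oarc e \<subseteq> inside J" for e
  have sub: "pedges ps \<subseteq> graph_edges V E" if "successively E ps" for ps
    using pedges_graph[OF sg that] .
  have len: "length ps \<ge> 2" if "hd ps = x" "last ps = y" "x \<in> set ps" for ps
    using that xy by (cases ps rule: pedges.cases) auto
  have cl: "closed J"
    unfolding J_def using sub A B by (intro closed_drawn) auto
  have op: "open (inside J)" "open (outside J)"
    using cl open_inside open_outside by auto
  have dich: "T \<subseteq> inside J \<or> T \<subseteq> outside J" if "connected T" "T \<inter> J = {}" for T
  proof -
    have "T \<subseteq> inside J \<union> outside J" using that(2) inside_Un_outside[of J] by blast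
    moreover have "inside J \<inter> outside J \<inter> T = {}" by simp
    ultimately have "inside J \<inter> T = {} \<or> outside J \<inter> T = {}"
      using connectedD[OF that(1) op] by blast
    then show ?thesis using \<open>T \<subseteq> inside J \<union> outside J\<close> by blast
  qed
  have not_both: False if "T \<subseteq> inside J" "T \<subseteq> outside J" "T \<noteq> {}" for T
    using that inside_Int_outside[of J] by blast
  have 1: "side {v, a} = side {v, b}" if v: "v \<notin> set A \<union> set B" and E: "E v a" "E v b" for v a b
  proof -
    let ?T = "oarc {v,a} \<union> {p v} \<union> oarc {v,b}"
    have e: "{v,a} \<in> graph_edges V E" "{v,b} \<in> graph_edges V E" using E edgeI by auto
    then have "v \<in> V" using edge_sub by blast
    have nin: "\<And>c. {v,c} \<notin> pedges A \<union> pedges B" using v pedges_subset by blast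
    have F: "pedges A \<union> pedges B \<subseteq> graph_edges V E" using sub A B by blast
    have "v \<notin> \<Union> (pedges A \<union> pedges B)" using v pedges_subset by blast
    then have "p v \<notin> J" unfolding J_def using vertex_drawn[OF F \<open>v \<in> V\<close>] by blast
    moreover have "oarc {v,a} \<inter> J = {}" "oarc {v,b} \<inter> J = {}"
      unfolding J_def using oarc_drawn[OF e(1) F nin] oarc_drawn[OF e(2) F nin] by auto
    ultimately have "?T \<inter> J = {}" by blast
    from dich[OF oarc_vertex_connected[OF E] this] show ?thesis
    proof
      assume "?T \<subseteq> inside J"
      then show ?thesis unfolding side_def by blast
    next
      assume "?T \<subseteq> outside J"
      then have "oarc {v,a} \<subseteq> outside J" "oarc {v,b} \<subseteq> outside J" by blast+
      then have "\<not> oarc {v,a} \<subseteq> inside J" "\<not> oarc {v,b} \<subseteq> inside J"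
        using not_both[OF _ _ oarc_nonempty[OF e(1)]] not_both[OF _ _ oarc_nonempty[OF e(2)]] by blast+
      then show ?thesis unfolding side_def by simp
    qed
  qed
  have 2: "side {a, hd (ws @ [b])} \<noteq> side {x, hd (tl C)}"
    if C: "successively E C" "distinct C" "hd C = x" "last C = y"
      and CAB: "set C \<inter> (set A \<union> set B) = {x, y}" and S: "successively E (a # ws @ [b])"
      and a: "a \<in> set A - {x, y}" and b: "b \<in> set B - {x, y}"
      and ws: "set ws \<inter> (set A \<union> set B \<union> set C) = {}"
    for C a ws b
  proof -
    have xs: "x \<in> set A" "x \<in> set B" "x \<in> set C" "y \<in> set A" "y \<in> set B" "y \<in> set C"
      using AB CAB by auto
    have l: "length A \<ge> 2" "length B \<ge> 2" "length C \<ge> 2"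
      using len A B C xs by auto
    have U: "\<Union> (pedges A) = set A" "\<Union> (pedges B) = set B" "\<Union> (pedges C) = set C"
      using l Union_pedges by auto
    have inV': "\<Union> (pedges P) \<subseteq> V" if "successively E P" for P
      using sub[OF that] edge_sub by blast
    then have inV: "set A \<subseteq> V" "set B \<subseteq> V" "set C \<subseteq> V"
      using U A(1) B(1) C(1) by metis+
    have nA: "{x,y} \<notin> pedges A" using hd_last_notin_pedges[OF A(2)] A a by auto
    have nB: "{x,y} \<notin> pedges B" using hd_last_notin_pedges[OF B(2)] B b by auto
    have pd: "pedges P \<inter> pedges Q = {}"
      if "{x,y} \<notin> pedges P" "successively E P" "set P \<inter> set Q = {x,y}" for P Q
    proof (rule ccontr)
      assume "pedges P \<inter> pedges Q \<noteq> {}"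
      then obtain e where e: "e \<in> pedges P" "e \<in> pedges Q" by blast
      then have "e \<subseteq> {x,y}" using pedges_subset that(3) by blast
      then have "e = {x,y}" using edge_eq_pair e(1) sub[OF that(2)] by blast
      then show False using e(1) that(1) by simp
    qed
    have AC: "set A \<inter> set C = {x,y}" and BC: "set B \<inter> set C = {x,y}"
      using CAB xs by auto
    have dis: "pedges A \<inter> pedges B = {}" "pedges A \<inter> pedges C = {}" "pedges B \<inter> pedges C = {}"
      using pd nA nB A(1) B(1) AB AC BC by auto
    obtain c1 where c1: "arc c1" "pathstart c1 = p x" "pathfinish c1 = p y" "path_image c1 = drawn (pedges A)"
      using path_arc[OF A(1,2) l(1)] A by blast
    obtain c2 where c2: "arc c2" "pathstart c2 = p x" "pathfinish c2 = p y" "path_image c2 = drawn (pedges B)"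
      using path_arc[OF B(1,2) l(2)] B by blast
    obtain c where c: "arc c" "pathstart c = p x" "pathfinish c = p y" "path_image c = drawn (pedges C)"
      using path_arc[OF C(1,2) l(3)] C by blast
    have ends: "{p x, p y} \<subseteq> path_image k" if "pathstart k = p x" "pathfinish k = p y" for k
      using that by (metis pathstart_in_path_image pathfinish_in_path_image insert_subset empty_subsetI)
    have meet: "path_image c1 \<inter> path_image c2 = {p x, p y}"
      "path_image c1 \<inter> path_image c = {p x, p y}" "path_image c2 \<inter> path_image c = {p x, p y}"
      using drawn_Int[OF sub[OF A(1)] sub[OF B(1)] dis(1)] drawn_Int[OF sub[OF A(1)] sub[OF C(1)] dis(2)]
        drawn_Int[OF sub[OF B(1)] sub[OF C(1)] dis(3)] ends[OF c1(2,3)] ends[OF c2(2,3)] ends[OF c(2,3)]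
      unfolding U AB AC BC c1(4) c2(4) c(4) by auto
    let ?T = "\<Union> (oarc ` pedges (a # ws @ [b])) \<union> p ` set ws"
    have Tcon: "connected ?T" by (rule walk_connected[OF S])
    let ?F = "pedges A \<union> pedges B \<union> pedges C"
    have F: "?F \<subseteq> graph_edges V E" using sub A(1) B(1) C(1) by blast
    have Sg: "pedges (a # ws @ [b]) \<subseteq> graph_edges V E" by (rule sub[OF S])
    have US: "\<Union> (pedges (a # ws @ [b])) = set (a # ws @ [b])" by (rule Union_pedges) simp
    have "oarc e \<inter> drawn ?F = {}" if e: "e \<in> pedges (a # ws @ [b])" for e
    proof (rule oarc_drawn[OF _ F])
      show "e \<in> graph_edges V E" using Sg e by blast
      show "e \<notin> ?F"
      proof
        assume f: "e \<in> ?F"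
        consider "e = {a, b}" | w where "w \<in> set ws" "w \<in> e" using pedges_inner[OF e] by blast
        then show False
        proof cases
          case 1
          then have "{a,b} \<subseteq> set A \<or> {a,b} \<subseteq> set B \<or> {a,b} \<subseteq> set C"
            using f pedges_subset by blast
          then show False using a b AB AC BC by blast
        next
          case 2
          then have "w \<in> set A \<union> set B \<union> set C" using f pedges_subset by blast
          then show False using 2 ws by blast
        qed
      qed
    qed
    moreover have "p w \<notin> drawn ?F" if "w \<in> set ws" for w
    proof (rule vertex_drawn[OF F])
      show "w \<in> V" using that US Sg edge_sub by force
      show "w \<notin> \<Union> ?F" using that ws U by auto
    qed
    ultimately have Tdis: "?T \<inter> drawn ?F = {}" by blast
    have Fun: "drawn ?F = path_image c1 \<union> path_image c2 \<union> path_image c"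
      unfolding drawn_def c1(4) c2(4) c(4) by blast
    have Jun: "J = path_image c1 \<union> path_image c2"
      unfolding J_def drawn_def c1(4) c2(4) by blast
    have TJ: "?T \<inter> J = {}" using Tdis unfolding Fun Jun by blast
    have clos: "p v \<in> closure ?T" if v: "v \<in> {a, b}" for v
    proof -
      obtain e where e: "e \<in> pedges (a # ws @ [b])" "v \<in> e" using US v by auto
      then have "p v \<in> closure (oarc e)" using oarc_closure Sg by blast
      then show ?thesis using closure_mono[of "oarc e" ?T] e(1) by blast
    qed
    have inj: "p v \<noteq> p w" if "v \<in> V" "w \<in> V" "v \<noteq> w" for v w
      using inj_p that by (auto simp: inj_on_def)
    have onp: "p v \<in> drawn (pedges P)" if "v \<in> \<Union> (pedges P)" "pedges P \<subseteq> graph_edges V E" for v P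
      unfolding drawn_def using that vertices_edge by blast
    have V: "a \<in> V" "b \<in> V" "x \<in> V" "y \<in> V" using a b xs inV by blast+
    have pa: "p a \<in> path_image c1 - {p x, p y}"
      using a onp[of a A] U sub[OF A(1)] inj[OF V(1,3)] inj[OF V(1,4)] c1(4) by auto
    have pb: "p b \<in> path_image c2 - {p x, p y}"
      using b onp[of b B] U sub[OF B(1)] inj[OF V(2,3)] inj[OF V(2,4)] c2(4) by auto
    let ?C = "path_image c - {p x, p y}"
    have Ccon: "connected ?C"
      using connected_simple_path_endless[of c] c by (simp add: arc_imp_simple_path)
    have CJ: "?C \<inter> J = {}" unfolding Jun using meet by blast
    obtain c0 cs where Ceq: "C = x # c0 # cs"
      using l(3) C(3) by (cases C rule: pedges.cases) auto
    then have ec: "{x, hd (tl C)} \<in> pedges C" by simp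
    then have ecg: "{x, hd (tl C)} \<in> graph_edges V E" using sub[OF C(1)] by blast
    have oC: "oarc {x, hd (tl C)} \<subseteq> ?C"
    proof -
      have "oarc {x, hd (tl C)} \<subseteq> path_image c"
        using ec unfolding c(4) drawn_def oarc_def by blast
      then show ?thesis using oarc_vertex[OF ecg] inV xs by blast
    qed
    have oS: "oarc {a, hd (ws @ [b])} \<subseteq> ?T"
    proof -
      have "{a, hd (ws @ [b])} \<in> pedges (a # ws @ [b])" by (cases ws) auto
      then show ?thesis by blast
    qed
    have ne: "oarc {a, hd (ws @ [b])} \<noteq> {}"
    proof (rule oarc_nonempty)
      have "{a, hd (ws @ [b])} \<in> pedges (a # ws @ [b])" by (cases ws) auto
      then show "{a, hd (ws @ [b])} \<in> graph_edges V E" using Sg by blast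
    qed
    note theta = c1(1-3) c2(1-3) c(1-3) meet Tcon Tdis[unfolded Fun] clos[of a] pa clos[of b] pb
    have "\<not> (?T \<subseteq> inside J \<and> ?C \<subseteq> inside J)"
      unfolding Jun using theta_inside[OF theta] by blast
    moreover have "\<not> (?T \<subseteq> outside J \<and> ?C \<subseteq> outside J)"
      unfolding Jun using theta_outside[OF theta] by blast
    ultimately have "?T \<subseteq> inside J \<and> ?C \<subseteq> outside J \<or> ?T \<subseteq> outside J \<and> ?C \<subseteq> inside J"
      using dich[OF Tcon TJ] dich[OF Ccon CJ] by blast
    then show ?thesis
    proof
      assume h: "?T \<subseteq> inside J \<and> ?C \<subseteq> outside J"
      have "side {a, hd (ws @ [b])}" unfolding side_def using oS h by (meson order_trans)
      moreover have "\<not> side {x, hd (tl C)}"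
        unfolding side_def using oC h not_both[OF _ _ oarc_nonempty[OF ecg]] by (meson order_trans)
      ultimately show ?thesis by simp
    next
      assume h: "?T \<subseteq> outside J \<and> ?C \<subseteq> inside J"
      have "side {x, hd (tl C)}" unfolding side_def using oC h by (meson order_trans)
      moreover have "\<not> side {a, hd (ws @ [b])}"
        unfolding side_def using oS h not_both[OF _ _ ne] by (meson order_trans)
      ultimately show ?thesis by simp
    qed
  qed
  show thesis
    by (rule that[of side]) (use 1 2 in blast)+
qed

end

subsection \<open>Guarding geodesics\<close>

text \<open>The end point may lie outside the set, so that walks through a territory can end on its boundary.\<close>

inductive walk_in :: "('a \<Rightarrow> 'a \<Rightarrow> bool) \<Rightarrow> 'a set \<Rightarrow> nat \<Rightarrow> 'a \<Rightarrow> 'a \<Rightarrow> bool" for E R where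
  walk_in_0: "walk_in E R 0 x x"
| walk_in_Suc: "\<lbrakk>x \<in> R; E x y; walk_in E R n y z\<rbrakk> \<Longrightarrow> walk_in E R (Suc n) x z"

lemma walk_in_mono: "walk_in E R n x y \<Longrightarrow> R \<subseteq> R' \<Longrightarrow> walk_in E R' n x y"
  by (induction rule: walk_in.induct) (auto intro: walk_in.intros)

lemma walk_in_trans: "walk_in E R m x y \<Longrightarrow> walk_in E R n y z \<Longrightarrow> walk_in E R (m + n) x z"
  by (induction rule: walk_in.induct) (auto intro: walk_in.intros)

lemma walk_in_1: "x \<in> R \<Longrightarrow> E x y \<Longrightarrow> walk_in E R 1 x y"
  using walk_in_Suc[of x R E y 0 y] by (simp add: walk_in_0)

lemma walk_in_0_eq: "walk_in E R 0 x y \<Longrightarrow> x = y"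
  by (auto elim: walk_in.cases)

text \<open>As \<open>i\<close> and \<open>j\<close> range over all ordered pairs, no walk through
  \<open>R\<close> joins two vertices of \<open>C\<close> in fewer steps than \<open>C\<close> does.
  The form with two walks from a robber position \<open>r\<close> says directly that the interval of
  guarding positions against \<open>r\<close> is nonempty.\<close>

definition geodesic :: "('a \<Rightarrow> 'a \<Rightarrow> bool) \<Rightarrow> 'a set \<Rightarrow> 'a list \<Rightarrow> bool" where
  "geodesic E R C \<longleftrightarrow> (\<forall>r\<in>R. \<forall>i<length C. \<forall>j<length C. \<forall>m n.
     walk_in E R m r (C ! i) \<longrightarrow> walk_in E R n r (C ! j) \<longrightarrow> j \<le> i + m + n)"

text \<open>The case \<open>i = j\<close> forces \<open>C\<close> to avoid \<open>R\<close>. A plain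
  geodesic may run through \<open>R\<close>, as each new path does.\<close>

definition strict_geodesic :: "('a \<Rightarrow> 'a \<Rightarrow> bool) \<Rightarrow> 'a set \<Rightarrow> 'a list \<Rightarrow> bool" where
  "strict_geodesic E R C \<longleftrightarrow> (\<forall>r\<in>R. \<forall>i<length C. \<forall>j<length C. \<forall>m n.
     walk_in E R m r (C ! i) \<longrightarrow> walk_in E R n r (C ! j) \<longrightarrow> j < i + m + n)"

lemma strict_geodesic_imp_geodesic: "strict_geodesic E R C \<Longrightarrow> geodesic E R C"
  unfolding strict_geodesic_def geodesic_def using less_imp_le by blast

text \<open>The upper end of the interval of guarding positions; \<open>not_behind\<close> is the
  lower end. They are kept apart because a cop approaching a path from before its start satisfies
  only this one. For the same reason positions are integers.\<close>

definition not_past :: "('a \<Rightarrow> 'a \<Rightarrow> bool) \<Rightarrow> 'a set \<Rightarrow> 'a list \<Rightarrow> int \<Rightarrow> 'a \<Rightarrow> bool" where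
  "not_past E R C a r \<longleftrightarrow> (\<forall>j<length C. \<forall>n. walk_in E R n r (C ! j) \<longrightarrow> a \<le> int j + int n)"

definition not_behind :: "('a \<Rightarrow> 'a \<Rightarrow> bool) \<Rightarrow> 'a set \<Rightarrow> 'a list \<Rightarrow> int \<Rightarrow> 'a \<Rightarrow> bool" where
  "not_behind E R C a r \<longleftrightarrow> (\<forall>j<length C. \<forall>n. walk_in E R n r (C ! j) \<longrightarrow> int j - int n \<le> a)"

definition guards :: "('a \<Rightarrow> 'a \<Rightarrow> bool) \<Rightarrow> 'a set \<Rightarrow> 'a list \<Rightarrow> int \<Rightarrow> 'a \<Rightarrow> bool" where
  "guards E R C a r \<longleftrightarrow> not_past E R C a r \<and> not_behind E R C a r"

text \<open>A guard may stand outside the segment \<open>C\<close> that still matters; \<open>C\<close> occupies the positions from 0 of his rail.\<close>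

definition rail :: "('a \<Rightarrow> 'a \<Rightarrow> bool) \<Rightarrow> (int \<Rightarrow> 'a) \<Rightarrow> int \<Rightarrow> int \<Rightarrow> 'a list \<Rightarrow> bool" where
  "rail E q lo hi C \<longleftrightarrow> (\<forall>i. lo \<le> i \<and> i < hi \<longrightarrow> E (q i) (q (i + 1))) \<and> lo \<le> 0 \<and> int (length C) \<le> hi + 1 \<and>
     (\<forall>j<length C. q (int j) = C ! j)"

text \<open>The rail is quantified existentially: when a path is cut down to a segment, its guard
  keeps the old rail and need not return to the segment first.\<close>

definition tracks :: "('a \<Rightarrow> 'a \<Rightarrow> bool) \<Rightarrow> 'a set \<Rightarrow> 'a list \<Rightarrow> 'a \<Rightarrow> 'a \<Rightarrow> bool" where
  "tracks E R C c r \<longleftrightarrow> (\<exists>q lo hi a. rail E q lo hi C \<and> lo \<le> a \<and> a \<le> hi \<and> c = q a \<and> guards E R C a r)"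

lemma rail_step: "rail E q lo hi C \<Longrightarrow> lo \<le> i \<Longrightarrow> i < hi \<Longrightarrow> E (q i) (q (i + 1))"
  unfolding rail_def by blast

lemma rail_nth: "rail E q lo hi C \<Longrightarrow> j < length C \<Longrightarrow> q (int j) = C ! j"
  unfolding rail_def by blast

lemma not_past_step:
  assumes "not_past E R C a r" "r \<in> R" "r' = r \<or> E r r'"
  shows "not_past E R C (a - 1) r'"
  unfolding not_past_def
proof (intro allI impI)
  fix j n assume j: "j < length C" "walk_in E R n r' (C ! j)"
  then have "walk_in E R n r (C ! j) \<or> walk_in E R (Suc n) r (C ! j)" using assms walk_in_Suc by metis
  then show "a - 1 \<le> int j + int n" using assms(1) j unfolding not_past_def by fastforce
qed

lemma not_behind_step:
  assumes "not_behind E R C a r" "r \<in> R" "r' = r \<or> E r r'"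
  shows "not_behind E R C (a + 1) r'"
  unfolding not_behind_def
proof (intro allI impI)
  fix j n assume j: "j < length C" "walk_in E R n r' (C ! j)"
  then have "walk_in E R n r (C ! j) \<or> walk_in E R (Suc n) r (C ! j)" using assms walk_in_Suc by metis
  then show "int j - int n \<le> a + 1" using assms(1) j unfolding not_behind_def by fastforce
qed

text \<open>If a walk of length \<open>n\<close> to position \<open>j\<close> shows that
  \<open>a\<close> is behind, then \<open>a + 1\<close> is at most \<open>j - n\<close>, and
  \<open>geodesic\<close> bounds this by \<open>i + m\<close> for every other walk. In the strict
  version one more step is gained.\<close>

lemma geodesic_not_past:
  assumes "geodesic E R C" "r \<in> R" "\<not> not_behind E R C a r"
  shows "not_past E R C (a + 1) r"
  using assms unfolding geodesic_def not_behind_def not_past_def by force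

lemma geodesic_not_behind:
  assumes "geodesic E R C" "r \<in> R" "\<not> not_past E R C a r"
  shows "not_behind E R C (a - 1) r"
  using assms unfolding geodesic_def not_behind_def not_past_def by force

lemma strict_geodesic_not_past:
  assumes "strict_geodesic E R C" "r \<in> R" "\<not> not_behind E R C a r"
  shows "not_past E R C (a + 2) r"
  using assms unfolding strict_geodesic_def not_behind_def not_past_def by force

lemma strict_geodesic_not_behind:
  assumes "strict_geodesic E R C" "r \<in> R" "\<not> not_past E R C a r"
  shows "not_behind E R C (a - 2) r"
  using assms unfolding strict_geodesic_def not_behind_def not_past_def by force

text \<open>A cop who is behind stands before the last vertex of \<open>C\<close>, so his forced
  step forward stays on the rail; \<open>past_bound\<close> is the counterpart for steps
  back.\<close>

lemma behind_bound: "\<not> not_behind E R C a r \<Longrightarrow> a + 1 < int (length C)"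
  unfolding not_behind_def by force

lemma past_bound: "\<not> not_past E R C a r \<Longrightarrow> 0 < a"
  unfolding not_past_def by force

lemma not_past_antimono: "not_past E R C a r \<Longrightarrow> b \<le> a \<Longrightarrow> not_past E R C b r"
  unfolding not_past_def by force

lemma not_behind_mono: "not_behind E R C a r \<Longrightarrow> a \<le> b \<Longrightarrow> not_behind E R C b r"
  unfolding not_behind_def by force

lemma guards_subset: "guards E R C a r \<Longrightarrow> R' \<subseteq> R \<Longrightarrow> guards E R' C a r"
  unfolding guards_def not_past_def not_behind_def using walk_in_mono[of E R' _ r _ R] by blast

lemma geodesic_subset: "geodesic E R C \<Longrightarrow> R' \<subseteq> R \<Longrightarrow> geodesic E R' C"
  unfolding geodesic_def using walk_in_mono[of E R' _ _ _ R] by blast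

lemma strict_geodesic_subset: "strict_geodesic E R C \<Longrightarrow> R' \<subseteq> R \<Longrightarrow> strict_geodesic E R' C"
  unfolding strict_geodesic_def using walk_in_mono[of E R' _ _ _ R] by blast

lemma sublist_nth:
  assumes "sublist C D"
  obtains k where "k + length C \<le> length D" "\<And>i. i < length C \<Longrightarrow> C ! i = D ! (k + i)"
proof -
  from assms obtain X Y where "D = X @ C @ Y" by (auto simp: sublist_def)
  then show ?thesis by (intro that[of "length X"]) (auto simp: nth_append)
qed

lemma geodesic_sublist: "geodesic E R D \<Longrightarrow> sublist C D \<Longrightarrow> geodesic E R C"
proof -
  assume D: "geodesic E R D" and "sublist C D"
  then obtain k where k: "k + length C \<le> length D" "\<And>i. i < length C \<Longrightarrow> C ! i = D ! (k + i)"
    using sublist_nth by blast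
  show ?thesis unfolding geodesic_def
  proof (intro ballI allI impI)
    fix r i j m n assume "r \<in> R" "i < length C" "j < length C" "walk_in E R m r (C ! i)" "walk_in E R n r (C ! j)"
    then have "k + j \<le> k + i + m + n" using D k unfolding geodesic_def by simp
    then show "j \<le> i + m + n" by simp
  qed
qed

lemma strict_geodesic_sublist: "strict_geodesic E R D \<Longrightarrow> sublist C D \<Longrightarrow> strict_geodesic E R C"
proof -
  assume D: "strict_geodesic E R D" and "sublist C D"
  then obtain k where k: "k + length C \<le> length D" "\<And>i. i < length C \<Longrightarrow> C ! i = D ! (k + i)"
    using sublist_nth by blast
  show ?thesis unfolding strict_geodesic_def
  proof (intro ballI allI impI)
    fix r i j m n assume "r \<in> R" "i < length C" "j < length C" "walk_in E R m r (C ! i)" "walk_in E R n r (C ! j)"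
    then have "k + j < k + i + m + n" using D k unfolding strict_geodesic_def by simp
    then show "j < i + m + n" by simp
  qed
qed

text \<open>No cop moves: the segment and the smaller territory only drop constraints. The positions
  on the rail are shifted by \<open>k\<close>, so that the segment starts at 0 again.\<close>

lemma tracks_sublist:
  assumes "tracks E R D c r" "sublist C D" "R' \<subseteq> R"
  shows "tracks E R' C c r"
proof -
  obtain k where k: "k + length C \<le> length D" "\<And>i. i < length C \<Longrightarrow> C ! i = D ! (k + i)"
    using sublist_nth[OF assms(2)] by blast
  obtain q lo hi a where q: "rail E q lo hi D" "lo \<le> a" "a \<le> hi" "c = q a" "guards E R D a r"
    using assms(1) unfolding tracks_def by blast
  have "rail E (\<lambda>i. q (i + int k)) (lo - int k) (hi - int k) C"
    unfolding rail_def
  proof (intro conjI allI impI)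
    fix i assume "lo - int k \<le> i \<and> i < hi - int k"
    then have "E (q (i + int k)) (q (i + int k + 1))" using q(1) unfolding rail_def by auto
    then show "E (q (i + int k)) (q (i + 1 + int k))" by (simp add: algebra_simps)
  next
    fix j assume j: "j < length C"
    then have "k + j < length D" using k(1) by simp
    then have "q (int (k + j)) = D ! (k + j)" using q(1) unfolding rail_def by blast
    then show "q (int j + int k) = C ! j" using k j by (simp add: algebra_simps)
  qed (use q k in \<open>auto simp: rail_def\<close>)
  moreover have "guards E R' C (a - int k) r"
  proof -
    have g: "guards E R' D a r" using guards_subset q(5) assms(3) .
    show ?thesis unfolding guards_def not_past_def not_behind_def
    proof (intro conjI allI impI)
      fix j n assume j: "j < length C" "walk_in E R' n r (C ! j)"
      then have "walk_in E R' n r (D ! (k + j))" "k + j < length D" using k by auto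
      then have "a \<le> int (k + j) + int n \<and> int (k + j) - int n \<le> a"
        using g unfolding guards_def not_past_def not_behind_def by blast
      then show "a - int k \<le> int j + int n" "int j - int n \<le> a - int k" by auto
    qed
  qed
  ultimately show ?thesis unfolding tracks_def using q
    by (intro exI[of _ "\<lambda>i. q (i + int k)"] exI[of _ "lo - int k"] exI[of _ "hi - int k"] exI[of _ "a - int k"]) auto
qed

lemma successively_nth: "successively P xs \<Longrightarrow> Suc i < length xs \<Longrightarrow> P (xs ! i) (xs ! Suc i)"
proof (induction xs arbitrary: i)
  case (Cons x xs)
  then show ?case by (cases i; cases xs) auto
qed simp

text \<open>The rail of a cop on his way to a new path \<open>C\<close>: the approach
  \<open>P\<close> occupies the negative positions.\<close>

lemma rail_append:
  assumes "successively E (P @ C)"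
  shows "rail E (\<lambda>i. (P @ C) ! nat (i + int (length P))) (- int (length P)) (int (length C) - 1) C"
  unfolding rail_def
proof (intro conjI allI impI)
  fix i assume i: "- int (length P) \<le> i \<and> i < int (length C) - 1"
  let ?k = "nat (i + int (length P))"
  have "nat (i + 1 + int (length P)) = Suc ?k" using i by linarith
  moreover have "Suc ?k < length (P @ C)" using i by auto
  ultimately show "E ((P @ C) ! ?k) ((P @ C) ! nat (i + 1 + int (length P)))"
    using successively_nth[OF assms] by metis
qed (auto simp: nth_append nat_add_distrib)

text \<open>Exhibiting one resting cop \<open>i\<close> replaces counting the moving ones.\<close>

lemma cop_moveI:
  assumes "length cs = 3" "length cs' = 3" "i < 3" "cs' ! i = cs ! i"
    and "\<And>j. j < 3 \<Longrightarrow> cs' ! j = cs ! j \<or> E (cs ! j) (cs' ! j)"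
  shows "cop_move E 2 cs cs'"
proof -
  have "{j. j < length cs \<and> cs' ! j \<noteq> cs ! j} \<subseteq> {0, 1, 2} - {i}"
    using assms by auto
  then have "card {j. j < length cs \<and> cs' ! j \<noteq> cs ! j} \<le> card ({0, 1, 2} - {i})"
    by (intro card_mono) auto
  also have "\<dots> = 2" using assms(3) by (auto simp: card_Diff_singleton_if numeral_3_eq_3 less_Suc_eq)
  finally show ?thesis using assms unfolding cop_move_def by auto
qed

lemma capture_next:
  assumes "length cs = 3" "i < 3" "cs ! i = r \<or> E (cs ! i) r"
  shows "cop_win_C V E 2 cs r"
proof -
  obtain k :: nat where "k < 3" "k \<noteq> i" by (metis zero_less_numeral one_less_numeral_iff semiring_norm(77) zero_neq_one)
  then have "cop_move E 2 cs (cs[i := r])"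
    by (intro cop_moveI[of _ _ k]) (use assms in \<open>auto simp: nth_list_update\<close>)
  moreover have "cop_win_R V E 2 (cs[i := r]) r"
    using assms by (intro cop_win_C_cop_win_R.capR) (simp add: set_update_memI)
  ultimately show ?thesis by (rule cop_win_C_cop_win_R.moveC)
qed

section \<open>Answers of the guards and the approach of the third cop\<close>

locale cop_graph =
  fixes V :: "'a set" and E :: "'a \<Rightarrow> 'a \<Rightarrow> bool"
  assumes sg: "simple_graph V E" and cg: "connected_graph V E"
begin

lemma E_sym: "E u v \<Longrightarrow> E v u" and E_V: "E u v \<Longrightarrow> u \<in> V" "E u v \<Longrightarrow> v \<in> V"
  and finite_V: "finite V"
  using sg by (auto simp: simple_graph_def)

text \<open>The robber has a walk of length 1 to \<open>v\<close>, so the position of the guard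
  differs from that of \<open>v\<close> by at most 1. Thus stepping onto a guarded path is answered
  by capture.\<close>

lemma tracks_capture:
  assumes "tracks E R C c r" "r \<in> R" "v \<in> set C" "E r v"
  shows "c = v \<or> E c v"
proof -
  obtain q lo hi a where q: "rail E q lo hi C" "lo \<le> a" "a \<le> hi" "c = q a" "guards E R C a r"
    using assms(1) unfolding tracks_def by blast
  obtain j where j: "j < length C" "C ! j = v" using assms(3) by (auto simp: in_set_conv_nth)
  have "walk_in E R 1 r (C ! j)" using walk_in_1 assms j by metis
  then have "a \<le> int j + 1 \<and> int j - 1 \<le> a" using q(5) j unfolding guards_def not_past_def not_behind_def
    by fastforce
  then consider "a = int j" | "a + 1 = int j" | "a = int j + 1" by linarith
  then show ?thesis
  proof cases
    case 1
    then show ?thesis using q j unfolding rail_def by auto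
  next
    case 2
    have "a < hi" using 2 j q(1) unfolding rail_def by linarith
    then have "E (q a) (q (int j))" using rail_step[OF q(1,2)] 2 by simp
    then show ?thesis using rail_nth[OF q(1) j(1)] q(4) j by simp
  next
    case 3
    have "lo \<le> int j" using q(1) unfolding rail_def by linarith
    then have "E (q (int j)) (q (int j + 1))" using 3 q(3) by (intro rail_step[OF q(1)]) auto
    then show ?thesis using 3 rail_nth[OF q(1) j(1)] q(4) j E_sym by simp
  qed
qed

text \<open>A step of the robber overtakes the guard by at most one position at either end of the
  interval of guarding positions, and \<open>geodesic\<close> keeps this interval nonempty. So one
  step leads back into it.\<close>

lemma tracks_step:
  assumes "tracks E R C c r" "geodesic E R C" "r \<in> R" "r' \<in> R" "r' = r \<or> E r r'"
  obtains c' where "c' = c \<or> E c c'" "tracks E R C c' r'"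
proof -
  obtain q lo hi a where q: "rail E q lo hi C" "lo \<le> a" "a \<le> hi" "c = q a" "guards E R C a r"
    using assms(1) unfolding tracks_def by blast
  have s: "not_past E R C (a - 1) r'" "not_behind E R C (a + 1) r'"
    using not_past_step not_behind_step assms q(5) unfolding guards_def by metis+
  consider "guards E R C a r'" | "\<not> not_behind E R C a r'" | "\<not> not_past E R C a r'"
    unfolding guards_def by blast
  then show thesis
  proof cases
    case 1
    then show ?thesis using that[of c] q unfolding tracks_def by blast
  next
    case 2
    have g: "guards E R C (a + 1) r'"
      unfolding guards_def using geodesic_not_past[OF assms(2,4) 2] s by simp
    have "a + 1 \<le> hi" using behind_bound[OF 2] q unfolding rail_def by auto
    moreover have "E (q a) (q (a + 1))" using calculation q by (intro rail_step[OF q(1)]) auto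
    ultimately show ?thesis using that[of "q (a + 1)"] g q unfolding tracks_def by fastforce
  next
    case 3
    have g: "guards E R C (a - 1) r'"
      unfolding guards_def using geodesic_not_behind[OF assms(2,4) 3] s by simp
    have "lo \<le> a - 1" using past_bound[OF 3] q unfolding rail_def by auto
    moreover have "E (q (a - 1)) (q (a - 1 + 1))" using calculation q by (intro rail_step[OF q(1)]) auto
    then have "E (q a) (q (a - 1))" using E_sym by simp
    ultimately show ?thesis using that[of "q (a - 1)"] g q unfolding tracks_def by fastforce
  qed
qed

lemma walk_exists:
  assumes "u \<in> V" "v \<in> V"
  obtains ps where "successively E (ps @ [v])" "hd (ps @ [v]) = u"
proof -
  have "(u, v) \<in> {(x, y). x \<in> V \<and> y \<in> V \<and> E x y}\<^sup>*"
    using cg assms unfolding connected_graph_def by blast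
  then have "\<exists>ps. successively E (ps @ [v]) \<and> hd (ps @ [v]) = u"
  proof (induction rule: converse_rtrancl_induct)
    case base
    show ?case by (intro exI[of _ "[]"]) auto
  next
    case (step y z)
    then obtain ps where "successively E (ps @ [v])" "hd (ps @ [v]) = z" by blast
    with step show ?case by (intro exI[of _ "y # ps"]) (auto simp: successively_Cons)
  qed
  then show thesis using that by blast
qed

text \<open>Here \<open>m\<close> bounds the number of consecutive rounds in which the guard is forced to move.\<close>

definition slack :: "'a set \<Rightarrow> 'a list \<Rightarrow> int \<Rightarrow> 'a \<Rightarrow> nat \<Rightarrow> bool" where
  "slack R C a r m \<longleftrightarrow> not_past E R C (a + 1) r \<and> nat (int (length C) - a) \<le> m \<or>
     not_behind E R C (a - 1) r \<and> nat (a + 1) \<le> m"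

lemma slack_exists:
  assumes "strict_geodesic E R C" "r \<in> R"
  obtains m where "slack R C a r m"
proof (cases "not_past E R C (a + 1) r")
  case True
  then show thesis using that unfolding slack_def by blast
next
  case False
  then have "not_behind E R C (a - 1) r"
    using strict_geodesic_not_behind[OF assms False] by simp
  then show thesis using that unfolding slack_def by blast
qed

text \<open>In the first alternative of \<open>slack\<close> there is room above the guard. Then the
  robber's step cannot make him stand too far, so a forced move goes up, and strictness leaves room
  above the new position again. The direction thus persists, and the end of the path bounds the run.
  The second alternative is the mirror image.\<close>

lemma slack_forced_move:
  assumes s: "strict_geodesic E R C" and r: "r \<in> R" "r' \<in> R" "r' = r \<or> E r r'"
    and rail: "rail E q lo hi C" and a: "lo \<le> a" "a \<le> hi"
    and g: "guards E R C a r" and m: "slack R C a r m" and forced: "\<not> guards E R C a r'"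
  obtains a' m' where "lo \<le> a'" "a' \<le> hi" "E (q a) (q a')" "guards E R C a' r'" "slack R C a' r' m'" "m' < m"
proof -
  have st: "not_past E R C (a - 1) r'" "not_behind E R C (a + 1) r'"
    using not_past_step not_behind_step r g unfolding guards_def by metis+
  from m show thesis unfolding slack_def
  proof
    assume up: "not_past E R C (a + 1) r \<and> nat (int (length C) - a) \<le> m"
    then have "not_past E R C a r'" using not_past_step[of E R C "a + 1" r r'] r by simp
    then have nb: "\<not> not_behind E R C a r'" using forced unfolding guards_def by blast
    have past: "not_past E R C (a + 1 + 1) r'"
      using strict_geodesic_not_past[OF s r(2) nb] by (simp add: add.commute add.left_commute)
    have bd: "a + 1 < int (length C)" using behind_bound[OF nb] .
    then have hi: "a + 1 \<le> hi" using rail unfolding rail_def by linarith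
    show thesis
    proof (rule that)
      show "E (q a) (q (a + 1))" using rail_step[OF rail a(1)] hi by simp
      show "guards E R C (a + 1) r'"
        unfolding guards_def using st not_past_antimono[OF past] by simp
      show "slack R C (a + 1) r' (nat (int (length C) - (a + 1)))" unfolding slack_def using past by simp
      show "nat (int (length C) - (a + 1)) < m" using up bd by linarith
    qed (use a hi in auto)
  next
    assume dn: "not_behind E R C (a - 1) r \<and> nat (a + 1) \<le> m"
    then have "not_behind E R C a r'" using not_behind_step[of E R C "a - 1" r r'] r by simp
    then have np: "\<not> not_past E R C a r'" using forced unfolding guards_def by blast
    have beh: "not_behind E R C (a - 1 - 1) r'"
      using strict_geodesic_not_behind[OF s r(2) np] by simp
    have bd: "0 < a" using past_bound[OF np] .
    then have lo: "lo \<le> a - 1" using rail unfolding rail_def by linarith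
    show thesis
    proof (rule that)
      show "E (q a) (q (a - 1))" using rail_step[OF rail lo] a E_sym by simp
      show "guards E R C (a - 1) r'"
        unfolding guards_def using st not_behind_mono[OF beh] by simp
      show "slack R C (a - 1) r' (nat (a - 1 + 1))" unfolding slack_def using beh by simp
      show "nat (a - 1 + 1) < m" using dn bd by linarith
    qed (use a lo in auto)
  qed
qed

lemma cop_move_in_V:
  assumes "cop_move E k cs cs'" "set cs \<subseteq> V"
  shows "set cs' \<subseteq> V"
proof
  fix x assume "x \<in> set cs'"
  then obtain i where "i < length cs" "x = cs' ! i"
    using assms(1) by (auto simp: in_set_conv_nth cop_move_def)
  then show "x \<in> V" using assms E_V unfolding cop_move_def by (metis nth_mem subsetD)
qed

text \<open>Lexicographic induction on \<open>N\<close>, the length of rail ahead of the cop heading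
  for \<open>C3\<close>, and \<open>m\<close>. If the guard of \<open>C1\<close> is forced to move,
  the cop heading for \<open>C3\<close> rests and \<open>m\<close> drops. Otherwise the guard of
  \<open>C1\<close> rests; the cop heading for \<open>C3\<close> either has reached a guarding
  position, where \<open>H\<close> applies, or advances, and \<open>N\<close> drops while
  \<open>m\<close> is chosen afresh. The guard of \<open>C2\<close> may move in every round.\<close>

lemma chase_along_rail:
  assumes closed: "\<And>r v. r \<in> R \<Longrightarrow> E r v \<Longrightarrow> v \<in> R \<union> set C1 \<union> set C2"
    and s1: "strict_geodesic E R C1" and g2: "geodesic E R C2" and g3: "geodesic E R C3"
    and idx: "i1 < 3" "i2 < 3" "i3 < 3" "i1 \<noteq> i2" "i1 \<noteq> i3" "i2 \<noteq> i3"
    and r1: "rail E q1 lo1 hi1 C1" and r3: "rail E q3 lo3 hi3 C3"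
    and H: "\<And>cs r. \<lbrakk>length cs = 3; set cs \<subseteq> V; r \<in> R; tracks E R C1 (cs ! i1) r; tracks E R C2 (cs ! i2) r;
       tracks E R C3 (cs ! i3) r\<rbrakk> \<Longrightarrow> cop_win_R V E 2 cs r"
  shows "\<lbrakk>length cs = 3; r \<in> R; lo1 \<le> a1; a1 \<le> hi1; cs ! i1 = q1 a1; guards E R C1 a1 r;
     slack R C1 a1 r m; tracks E R C2 (cs ! i2) r; lo3 \<le> a3; a3 \<le> hi3; cs ! i3 = q3 a3;
     not_past E R C3 a3 r; nat (hi3 - a3) \<le> N; set cs \<subseteq> V\<rbrakk> \<Longrightarrow> cop_win_R V E 2 cs r"
proof (induction N arbitrary: m cs r a1 a3 rule: less_induct)
  case (less N)
  note IHN = less.IH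
  show ?case using less.prems
  proof (induction m arbitrary: cs r a1 a3 rule: less_induct)
    case (less m)
    note IHm = less.IH and prems = less.prems
    have idx3: "j = i1 \<or> j = i2 \<or> j = i3" if "j < 3" for j
      using that idx by linarith
    show ?case
    proof (cases "guards E R C3 a3 r")
      case True
      show ?thesis
        by (rule H) (use prems r1 r3 True in \<open>auto simp: tracks_def\<close>)
    next
      case False
      then have nb3: "\<not> not_behind E R C3 a3 r" using prems(12) unfolding guards_def by blast
      have c1: "tracks E R C1 (cs ! i1) r" using prems r1 unfolding tracks_def by blast
      show ?thesis
      proof (rule cop_win_C_cop_win_R.moveR)
        fix r' assume r': "r' \<in> V" "r' = r \<or> E r r'"
        show "cop_win_C V E 2 cs r'"
        proof (cases "r' \<in> R")
          case False
          then have E: "E r r'" "r' \<in> set C1 \<union> set C2" using closed r' prems(2) by blast+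
          then show ?thesis
          proof (elim UnE)
            assume "r' \<in> set C1"
            with tracks_capture[OF c1 prems(2)] E(1) idx prems(1) show ?thesis
              by (intro capture_next[of _ i1]) auto
          next
            assume "r' \<in> set C2"
            with tracks_capture[OF prems(8,2)] E(1) idx prems(1) show ?thesis
              by (intro capture_next[of _ i2]) auto
          qed
        next
          case True
          obtain c2 where c2: "c2 = cs ! i2 \<or> E (cs ! i2) c2" "tracks E R C2 c2 r'"
            using tracks_step[OF prems(8) g2 prems(2) True r'(2)] by blast
          \<comment> \<open>Before the robber's move the cop was behind, so even the next position
            was not past; this absorbs the effect of the move.\<close>
          have np3: "not_past E R C3 a3 r'"
            using not_past_step[OF geodesic_not_past[OF g3 prems(2) nb3] prems(2) r'(2)] by simp
          show ?thesis
          proof (cases "guards E R C1 a1 r'")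
            case g1: True
            show ?thesis
            proof (cases "guards E R C3 a3 r'")
              case g3': True
              let ?cs = "cs[i2 := c2]"
              have mv: "cop_move E 2 cs ?cs"
                by (rule cop_moveI[of _ _ i1]) (use prems idx c2 in \<open>auto simp: nth_list_update\<close>)
              have "cop_win_R V E 2 ?cs r'"
                by (rule H) (use cop_move_in_V[OF mv] prems idx c2 True g1 g3' r1 r3 in \<open>auto simp: tracks_def\<close>)
              with mv show ?thesis by (rule cop_win_C_cop_win_R.moveC)
            next
              case False
              then have nb3': "\<not> not_behind E R C3 a3 r'" using np3 unfolding guards_def by blast
              have hi: "a3 < hi3" using behind_bound[OF nb3'] r3 unfolding rail_def by linarith
              let ?cs = "cs[i2 := c2, i3 := q3 (a3 + 1)]"
              have mv: "cop_move E 2 cs ?cs"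
                by (rule cop_moveI[of _ _ i1])
                  (use prems idx c2 hi rail_step[OF r3, of a3] in \<open>auto simp: nth_list_update\<close>)
              obtain m' where m': "slack R C1 a1 r' m'" using slack_exists[OF s1 True] .
              have "cop_win_R V E 2 ?cs r'"
              proof (rule IHN)
                show "nat (hi3 - (a3 + 1)) < N" using prems(13) hi by linarith
                show "not_past E R C3 (a3 + 1) r'" by (rule geodesic_not_past[OF g3 True nb3'])
              qed (use cop_move_in_V[OF mv] prems idx c2 True g1 m' hi in auto)
              with mv show ?thesis by (rule cop_win_C_cop_win_R.moveC)
            qed
          next
            case False
            obtain a1' m' where a1': "lo1 \<le> a1'" "a1' \<le> hi1" "E (q1 a1) (q1 a1')" "guards E R C1 a1' r'"
                "slack R C1 a1' r' m'" "m' < m"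
              using slack_forced_move[OF s1 prems(2) True r'(2) r1 prems(3,4,6,7) False] by blast
            let ?cs = "cs[i1 := q1 a1', i2 := c2]"
            have mv: "cop_move E 2 cs ?cs"
              by (rule cop_moveI[of _ _ i3]) (use prems idx c2 a1' in \<open>auto simp: nth_list_update\<close>)
            have "cop_win_R V E 2 ?cs r'"
              by (rule IHm[OF a1'(6)]) (use cop_move_in_V[OF mv] prems idx c2 True a1' np3 in auto)
            with mv show ?thesis by (rule cop_win_C_cop_win_R.moveC)
          qed
        qed
      qed
    qed
  qed
qed

lemma chase:
  assumes closed: "\<And>r v. r \<in> R \<Longrightarrow> E r v \<Longrightarrow> v \<in> R \<union> set C1 \<union> set C2"
    and s1: "strict_geodesic E R C1" and g2: "geodesic E R C2" and g3: "geodesic E R C3"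
    and C3: "C3 \<noteq> []" "successively E C3" "set C3 \<subseteq> V"
    and idx: "i1 < 3" "i2 < 3" "i3 < 3" "i1 \<noteq> i2" "i1 \<noteq> i3" "i2 \<noteq> i3"
    and H: "\<And>cs r. \<lbrakk>length cs = 3; set cs \<subseteq> V; r \<in> R; tracks E R C1 (cs ! i1) r; tracks E R C2 (cs ! i2) r;
       tracks E R C3 (cs ! i3) r\<rbrakk> \<Longrightarrow> cop_win_R V E 2 cs r"
    and cs: "length cs = 3" "set cs \<subseteq> V" "r \<in> R" "tracks E R C1 (cs ! i1) r" "tracks E R C2 (cs ! i2) r"
  shows "cop_win_R V E 2 cs r"
proof -
  have "hd C3 \<in> V" "cs ! i3 \<in> V" using C3 cs idx by (auto simp: subset_iff)
  then obtain ps where ps: "successively E (ps @ [hd C3])" "hd (ps @ [hd C3]) = cs ! i3"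
    using walk_exists by blast
  then have "successively E (ps @ C3)"
    using C3(1,2) by (auto simp: successively_append_iff)
  note r3 = rail_append[OF this]
  obtain q1 lo1 hi1 a1 where q1: "rail E q1 lo1 hi1 C1" "lo1 \<le> a1" "a1 \<le> hi1" "cs ! i1 = q1 a1" "guards E R C1 a1 r"
    using cs(4) unfolding tracks_def by blast
  obtain m where m: "slack R C1 a1 r m" using slack_exists[OF s1 cs(3)] .
  have start: "(ps @ C3) ! 0 = cs ! i3" using ps(2) C3(1) by (cases ps) (auto simp: hd_conv_nth)
  show ?thesis
  proof (rule chase_along_rail[OF closed s1 g2 g3 idx q1(1) r3 H])
    \<comment> \<open>A position that is at most 0 is never past.\<close>
    show "not_past E R C3 (- int (length ps)) r" unfolding not_past_def by auto
    show "- int (length ps) \<le> int (length C3) - 1" using C3(1) by (cases C3) auto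
    show "cs ! i3 = (ps @ C3) ! nat (- int (length ps) + int (length ps))" using start by simp
  qed (use cs q1 m in auto)
qed

section \<open>Blockades and the induction on the size of the territory\<close>

definition territory :: "'a set \<Rightarrow> bool" where
  "territory R \<longleftrightarrow> R \<noteq> {} \<and> R \<subseteq> V \<and> (\<forall>x\<in>R. \<forall>y\<in>R. \<exists>n. walk_in E R n x y)"

definition gpath :: "'a list \<Rightarrow> bool" where
  "gpath C \<longleftrightarrow> successively E C \<and> distinct C \<and> set C \<subseteq> V"

text \<open>For two paths this is a cycle cut at two vertices, with both parts directed alike, or
  else the same edge twice.\<close>

definition lens :: "'a list \<Rightarrow> 'a list \<Rightarrow> bool" where
  "lens C D \<longleftrightarrow> C \<noteq> [] \<and> D \<noteq> [] \<and> hd C = hd D \<and> last C = last D \<and> hd C \<noteq> last C \<and>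
     set C \<inter> set D = {hd C, last C}"

text \<open>An empty \<open>C2\<close> describes a territory confined by a single path, as at the
  start of the game.\<close>

definition blockade :: "'a set \<Rightarrow> 'a list \<Rightarrow> 'a list \<Rightarrow> bool" where
  "blockade R C1 C2 \<longleftrightarrow> territory R \<and> (\<forall>r\<in>R. \<forall>v. E r v \<longrightarrow> v \<in> R \<union> set C1 \<union> set C2) \<and>
     gpath C1 \<and> gpath C2 \<and> C1 \<noteq> [] \<and> set C1 \<inter> R = {} \<and> set C2 \<inter> R = {} \<and>
     strict_geodesic E R C1 \<and> geodesic E R C2 \<and> (C2 = [] \<or> lens C1 C2)"

text \<open>Here \<open>R'\<close> ranges over the components of the territory left by the new path.
  The pair \<open>(A, B)\<close> picks two different ones of the three guarded paths; their guards
  already track the new segments \<open>D1\<close> and \<open>D2\<close>, and the remaining cop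
  becomes free.\<close>

definition advance :: "'a set \<Rightarrow> 'a list \<Rightarrow> 'a list \<Rightarrow> 'a list \<Rightarrow> bool" where
  "advance R C1 C2 C3 \<longleftrightarrow> C3 \<noteq> [] \<and> gpath C3 \<and> geodesic E R C3 \<and> set C3 \<inter> R \<noteq> {} \<and>
     (\<forall>R'. territory R' \<longrightarrow> R' \<subseteq> R - set C3 \<longrightarrow> (\<forall>r\<in>R'. \<forall>v\<in>R. E r v \<longrightarrow> v \<in> R' \<union> set C3) \<longrightarrow>
       (\<exists>D1 D2 A B. blockade R' D1 D2 \<and> sublist D1 A \<and> sublist D2 B \<and>
          (A, B) \<in> {(C1, C2), (C2, C1), (C1, C3), (C3, C1), (C2, C3), (C3, C2)}))"

lemma walk_in_rev: "walk_in E S n x y \<Longrightarrow> y \<in> S \<Longrightarrow> walk_in E S n y x \<and> x \<in> S"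
proof (induction rule: walk_in.induct)
  case (walk_in_Suc x y n z)
  then have "walk_in E S n z y" "y \<in> S" by auto
  moreover have "walk_in E S 1 y x" using walk_in_1 E_sym walk_in_Suc calculation by metis
  ultimately have "walk_in E S (n + 1) z x" using walk_in_trans by metis
  then show ?case using walk_in_Suc by simp
qed (auto intro: walk_in_0)

lemma component:
  assumes "S \<subseteq> V" "r \<in> S"
  defines "K \<equiv> {y \<in> S. \<exists>n. walk_in E S n r y}"
  shows "territory K" "r \<in> K" "\<And>x v. x \<in> K \<Longrightarrow> E x v \<Longrightarrow> v \<in> S \<Longrightarrow> v \<in> K"
proof -
  show r: "r \<in> K" unfolding K_def using assms(2) walk_in_0[of E S r] by blast
  have *: "v \<in> K" if "x \<in> K" "E x v" "v \<in> S" for x v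
  proof -
    obtain n where "walk_in E S n r x" "x \<in> S" using \<open>x \<in> K\<close> unfolding K_def by blast
    then have "walk_in E S (n + 1) r v" using walk_in_trans walk_in_1 that by metis
    then show ?thesis using that(3) unfolding K_def by blast
  qed
  then show "\<And>x v. x \<in> K \<Longrightarrow> E x v \<Longrightarrow> v \<in> S \<Longrightarrow> v \<in> K" .
  have K: "walk_in E K n x y" if "walk_in E S n x y" "x \<in> K" "y \<in> S" for n x y
    using that
  proof (induction rule: walk_in.induct)
    case (walk_in_Suc x y n z)
    then have "y \<in> S" using walk_in_rev by blast
    then have "y \<in> K" using * walk_in_Suc by blast
    then show ?case using walk_in_Suc by (auto intro: walk_in.walk_in_Suc)
  qed (rule walk_in_0)
  show "territory K" unfolding territory_def
  proof (intro conjI ballI)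
    fix x y assume xy: "x \<in> K" "y \<in> K"
    then obtain m n where mn: "walk_in E S m r x" "walk_in E S n r y" "x \<in> S" "y \<in> S"
      unfolding K_def by blast
    then have "walk_in E S (m + n) x y" using walk_in_rev walk_in_trans by metis
    then show "\<exists>n. walk_in E K n x y" using K xy mn by blast
  next
    show "K \<noteq> {}" using r by blast
    show "K \<subseteq> V" using assms(1) unfolding K_def by blast
  qed
qed

lemma blockade_wins:
  assumes step: "\<And>R C1 C2. blockade R C1 C2 \<Longrightarrow> \<exists>C3. advance R C1 C2 C3"
  shows "\<lbrakk>blockade R C1 C2; i1 < 3; i2 < 3; i3 < 3; i1 \<noteq> i2; i1 \<noteq> i3; i2 \<noteq> i3; length cs = 3; set cs \<subseteq> V; r \<in> R;
    tracks E R C1 (cs ! i1) r; tracks E R C2 (cs ! i2) r\<rbrakk> \<Longrightarrow> cop_win_R V E 2 cs r"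
proof (induction "card R" arbitrary: R C1 C2 i1 i2 i3 cs r rule: less_induct)
  case less
  note IH = less.hyps and b = less.prems(1) and idx = less.prems(2-7)
  have bR: "territory R" "R \<subseteq> V" "strict_geodesic E R C1" "geodesic E R C2"
    "\<And>r v. r \<in> R \<Longrightarrow> E r v \<Longrightarrow> v \<in> R \<union> set C1 \<union> set C2"
    using b unfolding blockade_def territory_def by blast+
  obtain C3 where adv: "advance R C1 C2 C3" using step[OF b] by blast
  have C3: "C3 \<noteq> []" "gpath C3" "geodesic E R C3" "set C3 \<inter> R \<noteq> {}"
    using adv unfolding advance_def by blast+
  show ?case
  proof (rule chase[OF bR(5) bR(3,4) C3(3,1) _ _ idx])
    fix cs r assume cs: "length cs = 3" "set cs \<subseteq> V" "r \<in> R" and t: "tracks E R C1 (cs ! i1) r"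
      "tracks E R C2 (cs ! i2) r" "tracks E R C3 (cs ! i3) r"
    show "cop_win_R V E 2 cs r"
    proof (cases "r \<in> set C3")
      case True
      obtain q lo hi a where q: "rail E q lo hi C3" "cs ! i3 = q a" "guards E R C3 a r"
        using t(3) unfolding tracks_def by blast
      obtain j where j: "j < length C3" "C3 ! j = r" using True by (auto simp: in_set_conv_nth)
      \<comment> \<open>The empty walk from \<open>r\<close> to itself pins the guard to the
        robber's position.\<close>
      then have "a = int j" using q(3) walk_in_0[of E R r]
        unfolding guards_def not_past_def not_behind_def by fastforce
      then have "cs ! i3 = r" using rail_nth[OF q(1) j(1)] q(2) j(2) by simp
      then show ?thesis using cs idx by (intro cop_win_C_cop_win_R.capR) (auto simp: in_set_conv_nth)
    next
      case False
      let ?S = "R - set C3"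
      define K where "K = {y \<in> ?S. \<exists>n. walk_in E ?S n r y}"
      have SV: "?S \<subseteq> V" "r \<in> ?S" using bR(2) cs False by auto
      note K = component[OF SV, folded K_def]
      have KS: "K \<subseteq> ?S" by (auto simp: K_def)
      obtain D1 D2 A B where D: "blockade K D1 D2" "sublist D1 A" "sublist D2 B"
         "(A, B) \<in> {(C1, C2), (C2, C1), (C1, C3), (C3, C1), (C2, C3), (C3, C2)}"
        using adv K KS unfolding advance_def by blast
      have KR: "K \<subseteq> R" using KS by blast
      have "K \<subset> R" using KS C3(4) by blast
      then have cK: "card K < card R" using bR(2) finite_V finite_subset psubset_card_mono by metis
      have win: "cop_win_R V E 2 cs r" if "tracks E R A (cs ! j1) r" "tracks E R B (cs ! j2) r"
        "j1 < 3" "j2 < 3" "j3 < 3" "j1 \<noteq> j2" "j1 \<noteq> j3" "j2 \<noteq> j3" for j1 j2 j3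
        by (rule IH[OF cK D(1), of j1 j2 j3])
          (use that cs K(2) tracks_sublist[OF that(1) D(2) KR] tracks_sublist[OF that(2) D(3) KR] in auto)
      from D(4) consider "A = C1" "B = C2" | "A = C2" "B = C1" | "A = C1" "B = C3" | "A = C3" "B = C1"
        | "A = C2" "B = C3" | "A = C3" "B = C2" by auto
      then show ?thesis
      proof cases
        case 1 then show ?thesis using win[of i1 i2 i3] t idx by simp
      next
        case 2 then show ?thesis using win[of i2 i1 i3] t idx by simp
      next
        case 3 then show ?thesis using win[of i1 i3 i2] t idx by simp
      next
        case 4 then show ?thesis using win[of i3 i1 i2] t idx by simp
      next
        case 5 then show ?thesis using win[of i2 i3 i1] t idx by simp
      next
        case 6 then show ?thesis using win[of i3 i2 i1] t idx by simp
      qed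
    qed
  qed (use C3 less.prems in \<open>auto simp: gpath_def\<close>)
qed

lemma three_cops_win:
  assumes step: "\<And>R C1 C2. blockade R C1 C2 \<Longrightarrow> \<exists>C3. advance R C1 C2 C3"
  shows "cops_win V E 2 3"
proof -
  obtain v where v: "v \<in> V" using cg unfolding connected_graph_def by blast
  let ?cs = "[v, v, v]"
  have "cop_win_C V E 2 ?cs r" if r: "r \<in> V" for r
  proof (cases "r = v")
    case True
    then show ?thesis by (intro cop_win_C_cop_win_R.capC) simp
  next
    case False
    let ?S = "V - {v}"
    define K where "K = {y \<in> ?S. \<exists>n. walk_in E ?S n r y}"
    have S: "?S \<subseteq> V" "r \<in> ?S" using False r by auto
    note K = component[OF S, folded K_def]
    have KS: "K \<subseteq> ?S" by (auto simp: K_def)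
    have pos: "0 < n" if "r \<in> K" "walk_in E K n r v" for n r
      using that KS walk_in_0_eq[of E K r v] by (cases n) auto
    \<comment> \<open>A single vertex off the territory is a strict geodesic, since every walk to it
      has positive length.\<close>
    have "blockade K [v] []"
      unfolding blockade_def
    proof (intro conjI ballI allI impI)
      fix r v' assume "r \<in> K" "E r v'"
      then show "v' \<in> K \<union> set [v] \<union> set []" using K(3)[of r v'] E_V by auto
    next
      show "strict_geodesic E K [v]" unfolding strict_geodesic_def using pos by fastforce
    qed (use K(1) v KS in \<open>auto simp: gpath_def geodesic_def\<close>)
    moreover have "tracks E K [v] v r" unfolding tracks_def
      by (intro exI[of _ "\<lambda>_. v"] exI[of _ "0::int"])
         (auto simp: rail_def guards_def not_past_def not_behind_def)
    moreover have "tracks E K [] v r" unfolding tracks_def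
      by (intro exI[of _ "\<lambda>_. v"] exI[of _ "0::int"])
         (auto simp: rail_def guards_def not_past_def not_behind_def)
    ultimately have "cop_win_R V E 2 ?cs r"
      by (intro blockade_wins[OF step, of K "[v]" "[]" 0 1 2]) (use v K in auto)
    \<comment> \<open>The cops have the first turn, which they spend resting.\<close>
    moreover have "cop_move E 2 ?cs ?cs" unfolding cop_move_def by simp
    ultimately show ?thesis by (rule cop_win_C_cop_win_R.moveC[rotated])
  qed
  then show ?thesis unfolding cops_win_def using v by (intro exI[of _ ?cs]) auto
qed

end

subsection \<open>Detours through the territory\<close>

lemma successively_glue:
  "successively P (xs @ y # zs) \<longleftrightarrow> successively P (xs @ [y]) \<and> successively P (y # zs)"
  by (auto simp: successively_append_iff)

lemma walk_in_imp_list: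
  assumes "walk_in E R n x y"
  obtains ws where "length ws = n" "set ws \<subseteq> R" "successively E (ws @ [y])" "hd (ws @ [y]) = x"
proof -
  from assms have "\<exists>ws. length ws = n \<and> set ws \<subseteq> R \<and> successively E (ws @ [y]) \<and> hd (ws @ [y]) = x"
  proof (induction rule: walk_in.induct)
    case (walk_in_0 x)
    show ?case by (intro exI[of _ "[]"]) auto
  next
    case (walk_in_Suc x y n z)
    then obtain ws where "length ws = n" "set ws \<subseteq> R" "successively E (ws @ [z])" "hd (ws @ [z]) = y"
      by blast
    with walk_in_Suc show ?case by (intro exI[of _ "x # ws"]) (auto simp: successively_Cons)
  qed
  then show thesis using that by blast
qed

lemma list_imp_walk_in:
  "successively E (ws @ [y]) \<Longrightarrow> set ws \<subseteq> R \<Longrightarrow> walk_in E R (length ws) (hd (ws @ [y])) y"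
  by (induction ws) (auto simp: successively_Cons intro: walk_in.intros)

lemma walk_in_cut:
  assumes "walk_in E R n x y" "y \<in> T"
  shows "\<exists>m. \<exists>z\<in>T. walk_in E (R - T) m x z"
  using assms
proof (induction rule: walk_in.induct)
  case (walk_in_Suc x y n z)
  show ?case
  proof (cases "x \<in> T")
    case True
    then show ?thesis using walk_in_0 by metis
  next
    case False
    then show ?thesis using walk_in_Suc by (meson DiffI walk_in.walk_in_Suc)
  qed
qed (use walk_in_0 in metis)

lemma walk_in_avoid:
  assumes "walk_in E R n x y"
  shows "walk_in E (R - T) n x y \<or> (\<exists>s\<in>T \<inter> R. \<exists>m. walk_in E R m s y)"
  using assms
proof (induction rule: walk_in.induct)
  case (walk_in_Suc x y n z)
  show ?case
  proof (cases "x \<in> T")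
    case True
    then show ?thesis using walk_in_Suc walk_in.walk_in_Suc by (metis IntI)
  next
    case False
    then show ?thesis using walk_in_Suc by (meson DiffI walk_in.walk_in_Suc)
  qed
qed (simp add: walk_in_0)

lemma walk_in_exit:
  assumes "walk_in E R n x y" "x \<in> K" "y \<in> R - K"
  shows "\<exists>u\<in>K. \<exists>v\<in>R - K. E u v"
  using assms
proof (induction rule: walk_in.induct)
  case (walk_in_Suc x y n z)
  then show ?case
    by (metis DiffI walk_in.cases)
qed simp

lemma walk_in_attached:
  assumes "walk_in E R n x y" "x \<in> R" "y \<notin> R"
  shows "0 < n" "\<exists>r\<in>R. E r y"
  using assms
proof (induction rule: walk_in.induct)
  case (walk_in_Suc x y n z)
  {
    case 2
    show ?case
      using walk_in_Suc 2 walk_in_0_eq by (metis walk_in.cases)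
  }
qed auto

text \<open>Every inner vertex off \<open>J\<close> passes the side on from one of its edges to the
  next, so all edges at inner vertices, including those that leave the walk, agree with its first
  edge.\<close>

lemma side_along:
  assumes side: "\<And>v a b. \<lbrakk>v \<notin> J; E v a; E v b\<rbrakk> \<Longrightarrow> side {v, a} = side {v, b}"
    and sym: "\<And>u v. E u v \<Longrightarrow> E v u"
  shows "\<lbrakk>successively E (a # zs @ [b]); set zs \<inter> J = {}; v \<in> set zs; E v w\<rbrakk>
    \<Longrightarrow> side {v, w} = side {a, hd (zs @ [b])}"
proof (induction zs arbitrary: a)
  case (Cons z zs)
  have E: "E z a" "E z (hd (zs @ [b]))" "successively E (z # zs @ [b])"
    using Cons.prems(1) sym by (auto simp: successively_Cons)
  have z: "z \<notin> J" using Cons.prems by auto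
  show ?case
  proof (cases "v = z")
    case True
    then show ?thesis using side[OF z _ E(1)] Cons.prems by (simp add: insert_commute)
  next
    case False
    then have "side {v, w} = side {z, hd (zs @ [b])}" using Cons.IH E Cons.prems by auto
    then show ?thesis using side[OF z E(2,1)] by (simp add: insert_commute)
  qed
qed simp

lemma side_walk_in:
  assumes side: "\<And>v a b. \<lbrakk>v \<notin> J; E v a; E v b\<rbrakk> \<Longrightarrow> side {v, a} = side {v, b}"
    and sym: "\<And>u v. E u v \<Longrightarrow> E v u"
    and "walk_in E K n u v" "K \<inter> J = {}" "v \<in> K" "E u a" "E v b"
  shows "side {u, a} = side {v, b}"
  using assms(3-7)
proof (induction arbitrary: a rule: walk_in.induct)
  case (walk_in_0 x)
  then show ?case using side[of x a b] by blast
next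
  case (walk_in_Suc x y n z)
  have "y \<in> K" using walk_in_Suc by (metis walk_in.cases)
  then have "side {y, x} = side {z, b}" using walk_in_Suc sym by blast
  moreover have "side {x, a} = side {x, y}" using side[of x a y] walk_in_Suc by blast
  ultimately show ?case by (simp add: insert_commute)
qed

context cop_graph
begin

text \<open>Requiring \<open>ws\<close> to be nonempty excludes an edge between two boundary
  vertices, so that occupying a chord always takes something from the territory.\<close>

definition chord :: "'a set \<Rightarrow> 'a \<Rightarrow> 'a list \<Rightarrow> 'a \<Rightarrow> bool" where
  "chord R u ws v \<longleftrightarrow> ws \<noteq> [] \<and> set ws \<subseteq> R \<and> successively E (u # ws @ [v])"

lemma successively_rev_E: "successively E ws \<Longrightarrow> successively E (rev ws)"
  using E_sym by (auto elim!: successively_mono)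

text \<open>Turns the two walks from \<open>r\<close> that occur in \<open>geodesic\<close> into one
  detour through \<open>r\<close> with \<open>m + n\<close> edges, by reversing the first one.
  Violated inequalities thus become detours.\<close>

lemma chordI:
  assumes "walk_in E R m r u" "walk_in E R n r v" "r \<in> R" "u \<notin> R" "v \<notin> R"
  obtains ws where "chord R u ws v" "Suc (length ws) = m + n" "r \<in> set ws"
proof -
  obtain ws1 where w1: "length ws1 = m" "set ws1 \<subseteq> R" "successively E (ws1 @ [u])" "hd (ws1 @ [u]) = r"
    using walk_in_imp_list[OF assms(1)] .
  obtain ws2 where w2: "length ws2 = n" "set ws2 \<subseteq> R" "successively E (ws2 @ [v])" "hd (ws2 @ [v]) = r"
    using walk_in_imp_list[OF assms(2)] .
  obtain zs1 where z1: "ws1 = r # zs1" using w1 assms by (cases ws1) auto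
  obtain zs2 where z2: "ws2 = r # zs2" using w2 assms by (cases ws2) auto
  have "successively E (u # rev zs1 @ [r])"
    using successively_rev_E[OF w1(3)] z1 by simp
  moreover have "successively E (r # zs2 @ [v])" using w2 z2 by simp
  ultimately have "successively E ((u # rev zs1) @ (r # zs2 @ [v]))"
    using successively_glue[of E "u # rev zs1" r "zs2 @ [v]"] by simp
  then have "chord R u (rev zs1 @ r # zs2) v"
    unfolding chord_def using w1 w2 z1 z2 by auto
  then show thesis by (rule that) (use w1 w2 z1 z2 in auto)
qed

lemma chord_walk_in:
  assumes "chord R u ws v" "i < length ws"
  shows "walk_in E R (Suc i) (ws ! i) u" "walk_in E R (length ws - i) (ws ! i) v"
proof -
  have s: "successively E (u # ws @ [v])" and R: "set ws \<subseteq> R" using assms by (auto simp: chord_def)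
  have "ws = take i ws @ ws ! i # drop (Suc i) ws" using id_take_nth_drop assms(2) .
  then obtain A B where ws: "ws = A @ ws ! i # B" "length A = i" using assms(2) by (metis length_take min.absorb4)
  have "successively E (u # A @ ws ! i # B @ [v])" using s ws(1) by (metis append.assoc append_Cons)
  then have 1: "successively E (u # A @ [ws ! i])" and 2: "successively E (ws ! i # B @ [v])"
    using successively_glue[of E "u # A" "ws ! i" "B @ [v]"] by simp_all
  have sub: "set A \<subseteq> R" "set B \<subseteq> R" "ws ! i \<in> R"
    using R arg_cong[OF ws(1), of set] by auto
  have "successively E ((ws ! i # rev A) @ [u])" using successively_rev_E[OF 1] by simp
  from list_imp_walk_in[OF this, of R] show "walk_in E R (Suc i) (ws ! i) u" using sub ws(2) by simp
  have "length ws = i + Suc (length B)" using ws by (metis length_append length_Cons)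
  moreover from list_imp_walk_in[of E "ws ! i # B" v R] have "walk_in E R (Suc (length B)) (ws ! i) v"
    using 2 sub by simp
  ultimately show "walk_in E R (length ws - i) (ws ! i) v" by simp
qed

lemma chord_mono: "chord R u ws v \<Longrightarrow> R \<subseteq> R' \<Longrightarrow> chord R' u ws v"
  unfolding chord_def by blast

lemma chord_shorten:
  assumes "chord R u ws v" "\<not> distinct ws"
  obtains ws' where "chord R u ws' v" "length ws' < length ws"
proof -
  obtain xs ys zs y where ws: "ws = xs @ [y] @ ys @ [y] @ zs" using not_distinct_decomp[OF assms(2)] by blast
  have "successively E ((u # xs) @ y # (ys @ y # zs @ [v]))"
    using assms(1) unfolding chord_def ws by simp
  then have 1: "successively E ((u # xs) @ [y])" and "successively E ((y # ys) @ y # (zs @ [v]))"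
    using successively_glue[of E "u # xs" y "ys @ y # zs @ [v]"] by simp_all
  then have "successively E (y # zs @ [v])"
    using successively_glue[of E "y # ys" y "zs @ [v]"] by simp
  with 1 have "successively E ((u # xs) @ y # (zs @ [v]))"
    using successively_glue[of E "u # xs" y "zs @ [v]"] by simp
  then have "chord R u (xs @ [y] @ zs) v"
    using assms(1) unfolding chord_def ws by auto
  then show thesis by (rule that) (simp add: ws)
qed

lemma shortest_chord:
  assumes "chord R u ws0 v"
  obtains ws where "chord R u ws v" "distinct ws" "\<And>ws'. chord R u ws' v \<Longrightarrow> length ws \<le> length ws'"
proof -
  obtain ws where "chord R u ws v" "\<And>ws'. chord R u ws' v \<Longrightarrow> length ws \<le> length ws'"
    using ex_has_least_nat[of "\<lambda>ws. chord R u ws v" ws0 length] assms by blast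
  moreover from this have "distinct ws" using chord_shorten by (metis leD)
  ultimately show thesis using that by blast
qed

lemma chord_exists:
  assumes R: "territory R" and "a \<in> R" "b \<in> R" "E a u" "E b v" "u \<notin> R" "v \<notin> R"
  obtains ws where "chord R u ws v"
proof -
  obtain n where "walk_in E R n a b" using R assms unfolding territory_def by blast
  then have "walk_in E R (n + 1) a v" using walk_in_trans walk_in_1 assms by metis
  then show thesis using chordI[of R 1 a u "n + 1" v] walk_in_1 assms that by metis
qed

lemma walk_connected_set:
  "successively E ws \<Longrightarrow> s \<in> set ws \<Longrightarrow> t \<in> set ws \<Longrightarrow> \<exists>n. walk_in E (set ws) n s t"
proof (induction ws arbitrary: s t)
  case (Cons w ws)
  have *: "\<exists>n. walk_in E (set (w # ws)) n w t" if "t \<in> set (w # ws)" for t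
  proof (cases "t = w")
    case True
    then show ?thesis using walk_in_0 by metis
  next
    case False
    then have "t \<in> set ws" "ws \<noteq> []" using that by auto
    then have "E w (hd ws)" "successively E ws" using Cons.prems by (auto simp: successively_Cons)
    moreover obtain n where "walk_in E (set ws) n (hd ws) t"
      using Cons.IH[of "hd ws" t] \<open>t \<in> set ws\<close> \<open>ws \<noteq> []\<close> calculation by auto
    ultimately have "walk_in E (set (w # ws)) (Suc n) w t"
      using walk_in_mono[of E "set ws" n "hd ws" t "set (w # ws)"] by (intro walk_in_Suc) auto
    then show ?thesis by blast
  qed
  obtain m n where "walk_in E (set (w # ws)) m w s" "walk_in E (set (w # ws)) n w t" using * Cons.prems by metis
  then have "walk_in E (set (w # ws)) m s w" using walk_in_rev Cons.prems by metis
  then show ?case using walk_in_trans \<open>walk_in E (set (w # ws)) n w t\<close> by metis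
qed simp

text \<open>Pairs of positions on the same old part are covered by the assumptions on that part. In
  the remaining pairs a position on the chord is first moved along the chord to the old vertex
  \<open>u\<close> or \<open>v\<close>; so it suffices to compare old vertices from different parts,
  which is \<open>cross\<close>.\<close>

lemma geodesic_splice:
  assumes ch: "chord R u ws v"
    and gX: "geodesic E R (X @ [u])" and gY: "geodesic E R (v # Y)"
    and cross: "\<And>r p q m n. \<lbrakk>r \<in> R; p \<le> length X; q \<le> length Y; walk_in E R m r ((X @ [u]) ! p);
        walk_in E R n r ((v # Y) ! q)\<rbrakk> \<Longrightarrow> length X + Suc (length ws) + q \<le> p + m + n"
  shows "geodesic E R (X @ u # ws @ v # Y)"
  unfolding geodesic_def
proof (intro ballI allI impI)
  fix r i j m n
  let ?L = "X @ u # ws @ v # Y" and ?a = "length X" and ?k = "length ws"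
  assume r: "r \<in> R" and ij: "i < length ?L" "j < length ?L" and w: "walk_in E R m r (?L ! i)" "walk_in E R n r (?L ! j)"
  have left: "?L ! t = (X @ [u]) ! t" if "t \<le> ?a" for t
    using that by (auto simp: nth_append)
  have right: "?L ! t = (v # Y) ! (t - (?a + ?k + 1))" if t: "?a + ?k + 1 \<le> t" for t
  proof -
    obtain s where s: "t = ?a + ?k + 1 + s" using le_Suc_ex[OF t] by blast
    have "X @ u # ws @ v # Y = (X @ u # ws) @ v # Y" by simp
    moreover have "t = length (X @ u # ws) + s" using s by simp
    ultimately have "?L ! t = (v # Y) ! s" using nth_append_length_plus by metis
    then show ?thesis using s by simp
  qed
  have mid: "?L ! t = ws ! (t - ?a - 1)" if t: "?a < t" "t \<le> ?a + ?k" for t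
  proof -
    obtain s where "t = ?a + 1 + s" using t(1) by (metis Suc_eq_plus1 Suc_leI le_Suc_ex)
    then show ?thesis using t(2) by (simp add: nth_append)
  qed
  show "j \<le> i + m + n"
  proof (cases "i \<le> ?a + ?k \<and> ?a < j")
    case True
    \<comment> \<open>The old positions reached after this move. Truncated subtraction yields
      \<open>q = 0\<close>, the position of \<open>v\<close>, when \<open>j\<close> is on the
      chord.\<close>
    define p where "p = min i ?a"
    define q where "q = j - (?a + ?k + 1)"
    have 1: "walk_in E R (m + (i - p)) r ((X @ [u]) ! p)"
    proof (cases "i \<le> ?a")
      case True
      then show ?thesis using w(1) left unfolding p_def by (simp add: min_def)
    next
      case False
      then have t: "i - ?a - 1 < ?k" "?L ! i = ws ! (i - ?a - 1)" using True mid by auto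
      have "walk_in E R (m + Suc (i - ?a - 1)) r u"
        using walk_in_trans[OF w(1)[unfolded t(2)] chord_walk_in(1)[OF ch t(1)]] .
      moreover have "m + Suc (i - ?a - 1) = m + (i - p)" "(X @ [u]) ! p = u" using False unfolding p_def by auto
      ultimately show ?thesis by metis
    qed
    have 2: "walk_in E R (n + (?a + ?k + 1 - j)) r ((v # Y) ! q)"
    proof (cases "?a + ?k + 1 \<le> j")
      case True
      then show ?thesis using w(2) right unfolding q_def by simp
    next
      case False
      then have t: "j - ?a - 1 < ?k" "?L ! j = ws ! (j - ?a - 1)" using True mid by auto
      have "walk_in E R (n + (?k - (j - ?a - 1))) r v"
        using walk_in_trans[OF w(2)[unfolded t(2)] chord_walk_in(2)[OF ch t(1)]] .
      moreover have "?k - (j - ?a - 1) = ?a + ?k + 1 - j" "(v # Y) ! q = v" using False True unfolding q_def by auto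
      ultimately show ?thesis by metis
    qed
    have "?a + Suc ?k + q \<le> p + (m + (i - p)) + (n + (?a + ?k + 1 - j))"
      by (rule cross[OF r _ _ 1 2]) (use ij in \<open>auto simp: p_def q_def\<close>)
    then show ?thesis unfolding p_def q_def by (simp add: min_def split: if_splits)
  next
    case False
    show ?thesis
    proof (cases "j \<le> i")
      case True
      then show ?thesis by simp
    next
      case ji: False
      then consider "i \<le> ?a" "j \<le> ?a" | "?a + ?k + 1 \<le> i" "?a + ?k + 1 \<le> j" using False by linarith
      then show ?thesis
      proof cases
        case 1
        then show ?thesis using gX r w left[of i] left[of j] unfolding geodesic_def by simp
      next
        case 2
        have "j - (?a + ?k + 1) \<le> i - (?a + ?k + 1) + m + n"
        proof -
          have "i - (?a + ?k + 1) < length (v # Y)" "j - (?a + ?k + 1) < length (v # Y)"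
            using 2 ij by auto
          then show ?thesis using gY r w[unfolded right[OF 2(1)] right[OF 2(2)]] unfolding geodesic_def by blast
        qed
        then show ?thesis using 2 by linarith
      qed
    qed
  qed
qed

text \<open>The other way around the cycle: from \<open>a\<close> back along \<open>X\<close>,
  through the inner vertices of \<open>C\<close>, and back along \<open>Y\<close> to
  \<open>b\<close>. With the segment \<open>M\<close> and a detour from \<open>a\<close> to
  \<open>b\<close> it forms a theta graph.\<close>

lemma lens_outer_path:
  assumes L: "lens C (X @ a # M @ b # Y)" and C: "gpath C" and D: "gpath (X @ a # M @ b # Y)"
  obtains zs where "gpath (a # zs @ [b])" "set zs = (set C \<union> set X \<union> set Y) - {a, b}" "set zs \<inter> set M = {}"
proof -
  let ?D = "X @ a # M @ b # Y"
  let ?u = "hd C" and ?v = "last C"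
  have uv: "?u \<noteq> ?v" "hd ?D = ?u" "last ?D = ?v" "set C \<inter> set ?D = {?u, ?v}" "C \<noteq> []"
    using L by (auto simp: lens_def)
  obtain mid where mid: "C = ?u # mid @ [?v]"
    using uv(1,5) by (metis append_butlast_last_id list.collapse last_ConsL last_tl)
  have dC: "distinct (?u # mid @ [?v])" "successively E (?u # mid @ [?v])" "set C \<subseteq> V"
    using C mid by (auto simp: gpath_def)
  have dD: "distinct ?D" "successively E ?D" "set ?D \<subseteq> V"
    using D by (auto simp: gpath_def)
  have mD: "set mid \<inter> set ?D = {}"
  proof -
    have "set mid \<subseteq> set C" using mid by (metis set_subset_Cons set_append sup_ge1 order_trans)
    moreover have "?u \<notin> set mid" "?v \<notin> set mid" using dC by auto
    moreover have "z = ?u \<or> z = ?v" if "z \<in> set C" "z \<in> set ?D" for z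
      using uv(4) that by (metis IntI insertE singletonD)
    ultimately have "False" if "z \<in> set mid" "z \<in> set ?D" for z
      using that by (metis subsetD)
    then show ?thesis by (meson disjoint_iff)
  qed
  have sX: "successively E (X @ [a])" and sY: "successively E (b # Y)"
    using dD(2) by (auto simp: successively_append_iff successively_Cons)
  have ra: "successively E (a # rev X)" using successively_rev_E[OF sX] by simp
  have rb: "successively E (rev Y @ [b])" using successively_rev_E[OF sY] by simp
  have la: "last (a # rev X) = ?u" using uv(2) by (cases X) auto
  have hb: "hd (rev Y @ [b]) = ?v" using uv(3) by (cases Y rule: rev_cases) auto
  have "successively E ((a # rev X) @ mid @ (rev Y @ [b]))"
  proof (cases "mid = []")
    case True
    then have "E ?u ?v" using dC(2) by simp
    then show ?thesis using True ra rb la hb by (simp add: successively_append_iff[of E "a # rev X"] del: append_Cons)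
  next
    case False
    then have m: "E ?u (hd mid)" "E (last mid) ?v" "successively E mid"
      using dC(2) by (auto simp: successively_append_iff successively_Cons)
    have "successively E (mid @ (rev Y @ [b]))"
      unfolding successively_append_iff[of E mid] using m rb hb by simp
    then show ?thesis
      unfolding successively_append_iff[of E "a # rev X"] using m ra la False by simp
  qed
  then have "gpath (a # (rev X @ mid @ rev Y) @ [b])"
  proof -
    have "set mid \<subseteq> V" using dC(3) arg_cong[OF mid, of set] by auto
    moreover have "distinct mid" using dC(1) by simp
    moreover have "set (rev X) \<inter> set mid = {}" "a \<notin> set mid" "b \<notin> set mid" "set Y \<inter> set mid = {}" using mD by auto
    moreover have "distinct X" "distinct Y" "a \<noteq> b" "a \<notin> set X" "a \<notin> set Y" "b \<notin> set X" "b \<notin> set Y" "set X \<inter> set Y = {}"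
      using dD(1) by auto
    moreover have "a \<in> V" "b \<in> V" "set X \<subseteq> V" "set Y \<subseteq> V" using dD(3) by auto
    ultimately show ?thesis
      using \<open>successively E ((a # rev X) @ mid @ (rev Y @ [b]))\<close> unfolding gpath_def by (simp add: Int_commute) blast
  qed
  moreover have "set (rev X @ mid @ rev Y) = (set C \<union> set X \<union> set Y) - {a, b}"
  proof -
    have "set C = insert ?u (insert ?v (set mid))" using arg_cong[OF mid, of set] by simp
    moreover have "?u \<in> set X \<or> ?u = a" using uv(2) by (cases X) auto
    moreover have "?v \<in> set Y \<or> ?v = b" using uv(3) by (cases Y rule: rev_cases) auto
    moreover have "a \<notin> set X \<union> set mid \<union> set Y" "b \<notin> set X \<union> set mid \<union> set Y" using dD(1) mD by auto
    ultimately show ?thesis by auto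
  qed
  moreover have "set (rev X @ mid @ rev Y) \<inter> set M = {}" using dD(1) mD by auto
  ultimately show thesis using that by blast
qed

section \<open>Advances that are possible without planarity\<close>

lemma advance_commute: "advance R C1 C2 C3 \<Longrightarrow> advance R C2 C1 C3"
  unfolding advance_def
proof (elim conjE, intro conjI allI impI)
  fix R' assume *: "\<forall>R'. territory R' \<longrightarrow> R' \<subseteq> R - set C3 \<longrightarrow> (\<forall>r\<in>R'. \<forall>v\<in>R. E r v \<longrightarrow> v \<in> R' \<union> set C3) \<longrightarrow>
       (\<exists>D1 D2 A B. blockade R' D1 D2 \<and> sublist D1 A \<and> sublist D2 B \<and>
          (A, B) \<in> {(C1, C2), (C2, C1), (C1, C3), (C3, C1), (C2, C3), (C3, C2)})"
    and R': "territory R'" "R' \<subseteq> R - set C3" "\<forall>r\<in>R'. \<forall>v\<in>R. E r v \<longrightarrow> v \<in> R' \<union> set C3"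
  then obtain D1 D2 A B where "blockade R' D1 D2 \<and> sublist D1 A \<and> sublist D2 B"
          and AB: "(A, B) \<in> {(C1, C2), (C2, C1), (C1, C3), (C3, C1), (C2, C3), (C3, C2)}" by blast
  moreover have "(A, B) \<in> {(C2, C1), (C1, C2), (C2, C3), (C3, C2), (C1, C3), (C3, C1)}" using AB by auto
  ultimately show "\<exists>D1 D2 A B. blockade R' D1 D2 \<and> sublist D1 A \<and> sublist D2 B \<and>
          (A, B) \<in> {(C2, C1), (C1, C2), (C2, C3), (C3, C2), (C1, C3), (C3, C1)}" by blast
qed auto

lemma blockadeD:
  assumes "blockade R C1 C2"
  shows "territory R" "R \<subseteq> V" "R \<noteq> {}" "gpath C1" "gpath C2" "C1 \<noteq> []" "set C1 \<inter> R = {}" "set C2 \<inter> R = {}"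
    "strict_geodesic E R C1" "geodesic E R C2" "C2 = [] \<or> lens C1 C2"
    "\<And>r v. r \<in> R \<Longrightarrow> E r v \<Longrightarrow> v \<in> R \<union> set C1 \<union> set C2"
  using assms unfolding blockade_def territory_def by blast+

text \<open>Any two walks from the territory to \<open>C\<close> end in the same vertex, and they
  have positive length.\<close>

lemma few_attached_strict:
  assumes "set C \<inter> R = {}"
    and "\<And>i j r s. \<lbrakk>i < length C; j < length C; r \<in> R; s \<in> R; E r (C ! i); E s (C ! j)\<rbrakk> \<Longrightarrow> i = j"
  shows "strict_geodesic E R C"
  unfolding strict_geodesic_def
proof (intro ballI allI impI)
  fix r i j m n assume *: "r \<in> R" "i < length C" "j < length C" "walk_in E R m r (C ! i)" "walk_in E R n r (C ! j)"
  then have "C ! i \<notin> R" "C ! j \<notin> R" using assms(1) nth_mem by blast+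
  then have "0 < m" "\<exists>r\<in>R. E r (C ! i)" "\<exists>r\<in>R. E r (C ! j)" using * walk_in_attached by metis+
  then show "j < i + m + n" using assms(2) * by fastforce
qed

text \<open>The new path consists of the only exit \<open>x\<close> and a neighbour \<open>s\<close>
  of it, so the territory loses \<open>s\<close>. Against a territory off both vertices it is
  strict: its two positions differ by at most 1, and both walks have length at least 1.\<close>

lemma advance_single:
  assumes b: "blockade R C1 C2" and x: "x \<notin> R" "s \<in> R" "E s x"
    and only: "\<And>r v. r \<in> R \<Longrightarrow> E r v \<Longrightarrow> v \<in> R \<or> v = x"
  shows "advance R C1 C2 [x, s]"
  unfolding advance_def
proof (intro conjI allI impI)
  have xV: "x \<in> V" "s \<in> V" "x \<noteq> s" "E x s" using E_V E_sym x by auto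
  show g: "gpath [x, s]" using xV by (simp add: gpath_def)
  show "geodesic E R [x, s]" unfolding geodesic_def
  proof (intro ballI allI impI)
    fix r i j m n assume *: "i < length [x, s]" "j < length [x, s]" "walk_in E R m r ([x, s] ! i)" "walk_in E R n r ([x, s] ! j)"
    show "j \<le> i + m + n"
    proof (cases "m = 0 \<and> n = 0")
      case True
      then have "[x, s] ! i = [x, s] ! j" using * walk_in_0_eq by metis
      then show ?thesis using * xV by (auto simp: less_Suc_eq)
    next
      case False
      then show ?thesis using * by auto
    qed
  qed
  show "set [x, s] \<inter> R \<noteq> {}" using x by auto
  fix R' assume R': "territory R'" "R' \<subseteq> R - set [x, s]" "\<forall>r\<in>R'. \<forall>v\<in>R. E r v \<longrightarrow> v \<in> R' \<union> set [x, s]"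
  have "blockade R' [x, s] []" unfolding blockade_def
  proof (intro conjI ballI allI impI)
    fix r v assume "r \<in> R'" "E r v"
    then show "v \<in> R' \<union> set [x, s] \<union> set []" using only[of r v] R' by auto
  next
    show "strict_geodesic E R' [x, s]" unfolding strict_geodesic_def
    proof (intro ballI allI impI)
      fix r i j m n assume *: "r \<in> R'" "i < length [x, s]" "j < length [x, s]" "walk_in E R' m r ([x, s] ! i)" "walk_in E R' n r ([x, s] ! j)"
      then have "[x, s] ! i \<notin> R'" "[x, s] ! j \<notin> R'" using R'(2) nth_mem by blast+
      then have "0 < m" "0 < n" using * walk_in_attached by metis+
      then show "j < i + m + n" using * by simp
    qed
  qed (use R' g in \<open>auto simp: geodesic_def gpath_def\<close>)
  then show "\<exists>D1 D2 A B. blockade R' D1 D2 \<and> sublist D1 A \<and> sublist D2 B \<and>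
      (A, B) \<in> {(C1, C2), (C2, C1), (C1, [x, s]), ([x, s], C1), (C2, [x, s]), ([x, s], C2)}"
    by (intro exI[of _ "[x, s]"] exI[of _ "[]"] exI[of _ C1]) auto
qed simp

lemma chord_gpath:
  assumes "chord R u ws v" "distinct ws" "u \<notin> R" "v \<notin> R" "u \<noteq> v"
  shows "gpath (u # ws @ [v])"
  unfolding gpath_def
proof (intro conjI)
  have s: "successively E (u # ws @ [v])" "set ws \<subseteq> R" using assms by (auto simp: chord_def)
  show "successively E (u # ws @ [v])" by fact
  show "distinct (u # ws @ [v])" using s assms by auto
  have "set (u # ws @ [v]) = \<Union> (pedges (u # ws @ [v]))" using Union_pedges[of "u # ws @ [v]"] by simp
  also have "\<dots> \<subseteq> V" using pedges_graph[OF sg s(1)] by (auto simp: graph_edges_def)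
  finally show "set (u # ws @ [v]) \<subseteq> V" .
qed

lemma gpath_append:
  "gpath (X @ a # Y) \<longleftrightarrow> gpath (X @ [a]) \<and> gpath (a # Y) \<and> set X \<inter> set Y = {} \<and> set X \<inter> set (a # Y) = {}"
  unfolding gpath_def using successively_glue[of E X a Y] by auto

text \<open>Since no vertex of \<open>X\<close> has a neighbour in the territory, the comparison of
  walks to the two old parts only concerns \<open>u\<close> and \<open>v\<close>, where it is the
  minimality of the chord. The prefix \<open>X\<close> serves to close the cycle with
  \<open>D\<close>.\<close>

lemma shortest_chord_advance:
  assumes b: "blockade R C1 C2"
    and ch: "chord R u ws v" "distinct ws" "\<And>ws'. chord R u ws' v \<Longrightarrow> length ws \<le> length ws'"
    and uv: "u \<notin> R" "v \<notin> R" "u \<noteq> v"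
    and X: "gpath (X @ [u])" "set X \<inter> R = {}" "v \<notin> set X"
      "\<And>r x. r \<in> R \<Longrightarrow> x \<in> set X \<Longrightarrow> \<not> E r x"
    and D: "sublist D A" "A = C1 \<or> A = C2" "gpath D" "strict_geodesic E R D" "set D \<inter> R = {}"
      "lens D (X @ u # ws @ [v])"
    and only: "\<And>r w. r \<in> R \<Longrightarrow> E r w \<Longrightarrow> w \<in> R \<union> {u, v} \<union> set D"
  shows "advance R C1 C2 (X @ u # ws @ [v])"
  unfolding advance_def
proof (intro conjI allI impI)
  let ?L = "X @ u # ws @ [v]"
  have ws: "ws \<noteq> []" "set ws \<subseteq> R" using ch(1) by (auto simp: chord_def)
  show g: "gpath ?L"
  proof (rule gpath_append[THEN iffD2], intro conjI)
    show "gpath (u # ws @ [v])" by (rule chord_gpath[OF ch(1,2) uv])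
    show "gpath (X @ [u])" by fact
    then have "u \<notin> set X" by (auto simp: gpath_def)
    then show "set X \<inter> set (ws @ [v]) = {}" "set X \<inter> set (u # ws @ [v]) = {}" using X ws by auto
  qed
  have none: False if "r \<in> R" "walk_in E R m r (X ! i)" "i < length X" for r m i
  proof -
    have "X ! i \<notin> R" "X ! i \<in> set X" using X(2) that(3) by (auto simp: disjoint_iff)
    then show False using walk_in_attached(2)[OF that(2,1)] X(4) by blast
  qed
  show gL: "geodesic E R ?L"
  proof (rule geodesic_splice[OF ch(1), of X "[]"])
    have last: "p = length X" if "r \<in> R" "p \<le> length X" "walk_in E R m r ((X @ [u]) ! p)" for r p m
      using that none[of r m p] by (auto simp: nth_append split: if_splits)
    show "geodesic E R (X @ [u])"
      unfolding geodesic_def using last by (metis le_add1 length_append_singleton less_Suc_eq_le add.assoc)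
    show "geodesic E R [v]" unfolding geodesic_def by simp
    fix r p q m n
    assume *: "r \<in> R" "p \<le> length X" "q \<le> length ([]::'a list)" "walk_in E R m r ((X @ [u]) ! p)" "walk_in E R n r ([v] ! q)"
    then have "p = length X" "q = 0" using last by auto
    then have "walk_in E R m r u" "walk_in E R n r v" using * by auto
    then obtain ws' where "chord R u ws' v" "Suc (length ws') = m + n" using chordI *(1) uv by metis
    then show "length X + Suc (length ws) + q \<le> p + m + n" using ch(3)[of ws'] \<open>p = _\<close> \<open>q = 0\<close> by simp
  qed
  show "set ?L \<inter> R \<noteq> {}" using ws by (cases ws) auto
  fix R' assume R': "territory R'" "R' \<subseteq> R - set ?L" "\<forall>r\<in>R'. \<forall>v\<in>R. E r v \<longrightarrow> v \<in> R' \<union> set ?L"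
  have sub: "R' \<subseteq> R" using R' by blast
  have "blockade R' D ?L" unfolding blockade_def
  proof (intro conjI ballI allI impI)
    fix r w assume "r \<in> R'" "E r w"
    then show "w \<in> R' \<union> set D \<union> set ?L" using only[of r w] R' sub by fastforce
  next
    show "D \<noteq> []" using D(6) by (auto simp: lens_def)
    show "?L = [] \<or> lens D ?L" using D(6) by blast
  qed (use R' D g sub geodesic_subset[OF gL sub] strict_geodesic_subset[OF D(4) sub] in auto)
  then show "\<exists>D1 D2 A B. blockade R' D1 D2 \<and> sublist D1 A \<and> sublist D2 B \<and>
      (A, B) \<in> {(C1, C2), (C2, C1), (C1, ?L), (?L, C1), (C2, ?L), (?L, C2)}"
    using D(1,2) by blast
qed simp

end

subsection \<open>Using planarity\<close>

locale planar_cop_graph = cop_graph +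
  assumes planar: "planar_graph V E"
begin

text \<open>The drawing disappears behind \<open>side\<close> here; what follows is
  combinatorial.\<close>

lemma path_sides:
  assumes A: "gpath (a # M @ [b])" and B: "gpath (a # N @ [b])" and MN: "set M \<inter> set N = {}"
  obtains side where
    "\<And>v x y. \<lbrakk>v \<notin> {a, b} \<union> set M \<union> set N; E v x; E v y\<rbrakk> \<Longrightarrow> side {v, x} = side {v, y}"
    "\<And>zs z ws w. \<lbrakk>gpath (a # zs @ [b]); set zs \<inter> (set M \<union> set N) = {}; z \<in> set M; w \<in> set N;
        successively E (z # ws @ [w]); set ws \<inter> ({a, b} \<union> set M \<union> set N \<union> set zs) = {}\<rbrakk>
      \<Longrightarrow> side {z, hd (ws @ [w])} = (\<not> side {a, hd (zs @ [b])})"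
proof -
  obtain p \<gamma> where "drawing V E p \<gamma>"
    using planar sg unfolding planar_graph_def drawing_def by metis
  then interpret drawing V E p \<gamma> .
  have ab: "a \<noteq> b" "a \<notin> set M" "a \<notin> set N" "b \<notin> set M" "b \<notin> set N"
    using A B by (auto simp: gpath_def)
  have *: "set (a # M @ [b]) \<inter> set (a # N @ [b]) = {a, b}" using ab MN by auto
  have sA: "successively E (a # M @ [b])" "distinct (a # M @ [b])" "hd (a # M @ [b]) = a" "last (a # M @ [b]) = b"
    using A by (simp_all add: gpath_def)
  have sB: "successively E (a # N @ [b])" "distinct (a # N @ [b])" "hd (a # N @ [b]) = a" "last (a # N @ [b]) = b"
    using B by (simp_all add: gpath_def)
  show thesis
  proof (rule sides[OF sA sB * ab(1)])
    fix side :: "'a set \<Rightarrow> bool"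
    assume 1: "\<And>v x y. \<lbrakk>v \<notin> set (a # M @ [b]) \<union> set (a # N @ [b]); E v x; E v y\<rbrakk> \<Longrightarrow> side {v, x} = side {v, y}"
      and 2: "\<And>C z ws w. \<lbrakk>successively E C; distinct C; hd C = a; last C = b;
        set C \<inter> (set (a # M @ [b]) \<union> set (a # N @ [b])) = {a, b}; successively E (z # ws @ [w]);
        z \<in> set (a # M @ [b]) - {a, b}; w \<in> set (a # N @ [b]) - {a, b};
        set ws \<inter> (set (a # M @ [b]) \<union> set (a # N @ [b]) \<union> set C) = {}\<rbrakk>
      \<Longrightarrow> side {z, hd (ws @ [w])} \<noteq> side {a, hd (tl C)}"
    show thesis
    proof (rule that)
      fix v x y assume "v \<notin> {a, b} \<union> set M \<union> set N" "E v x" "E v y"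
      then show "side {v, x} = side {v, y}" by (intro 1) auto
    next
      fix zs z ws w assume h: "gpath (a # zs @ [b])" "set zs \<inter> (set M \<union> set N) = {}" "z \<in> set M" "w \<in> set N"
        "successively E (z # ws @ [w])" "set ws \<inter> ({a, b} \<union> set M \<union> set N \<union> set zs) = {}"
      have "side {z, hd (ws @ [w])} \<noteq> side {a, hd (tl (a # zs @ [b]))}"
        by (rule 2) (use h ab in \<open>auto simp: gpath_def\<close>)
      then show "side {z, hd (ws @ [w])} = (\<not> side {a, hd (zs @ [b])})" by auto
    qed
  qed
qed

text \<open>With a neighbour \<open>d\<close> of \<open>R'\<close> on the outer arc, each of
  \<open>a\<close>, \<open>b\<close> and \<open>R'\<close> would be joined to each of the segment,
  the detour and the outer arc, as in $K_{3,3}$. In terms of sides of the cycle through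
  \<open>M\<close> and \<open>ws\<close>: a walk through \<open>R'\<close> from \<open>M\<close> to
  \<open>ws\<close> and the outer arc are on different sides, but \<open>d\<close> would put them on
  the same one.\<close>

lemma theta_faces:
  assumes L: "lens C (X @ a # M @ b # Y)" and C: "gpath C" and D: "gpath (X @ a # M @ b # Y)"
    and dis: "set C \<inter> R = {}" "set (X @ a # M @ b # Y) \<inter> R = {}"
    and ch: "chord R a ws b" "distinct ws"
    and R': "territory R'" "R' \<subseteq> R - set ws"
    and att: "r0 \<in> R'" "z \<in> set M" "E r0 z" "r1 \<in> R'" "s1 \<in> set ws" "E r1 s1"
    and d: "r2 \<in> R'" "E r2 d" "d \<in> set C \<union> set X \<union> set Y"
  shows "d \<in> {a, b}"
proof (rule ccontr)
  assume nd: "d \<notin> {a, b}"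
  obtain zs where zs: "gpath (a # zs @ [b])" "set zs = (set C \<union> set X \<union> set Y) - {a, b}" "set zs \<inter> set M = {}"
    using lens_outer_path[OF L C D] .
  have wsR: "set ws \<subseteq> R" using ch by (auto simp: chord_def)
  have abR: "a \<notin> R" "b \<notin> R" "a \<noteq> b" "set M \<inter> R = {}" using dis(2) D by (auto simp: gpath_def)
  have gM: "gpath (a # M @ [b])"
  proof -
    have "gpath (a # M @ b # Y)" using D gpath_append by blast
    then show ?thesis using gpath_append[of "a # M" b Y] by simp
  qed
  obtain side where 1: "\<And>v x y. \<lbrakk>v \<notin> {a, b} \<union> set M \<union> set ws; E v x; E v y\<rbrakk> \<Longrightarrow> side {v, x} = side {v, y}"
    and 2: "\<And>zs z qs w. \<lbrakk>gpath (a # zs @ [b]); set zs \<inter> (set M \<union> set ws) = {}; z \<in> set M; w \<in> set ws;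
        successively E (z # qs @ [w]); set qs \<inter> ({a, b} \<union> set M \<union> set ws \<union> set zs) = {}\<rbrakk>
      \<Longrightarrow> side {z, hd (qs @ [w])} = (\<not> side {a, hd (zs @ [b])})"
    using path_sides[OF gM chord_gpath[OF ch abR(1-3)]] abR(4) wsR by blast
  have zsR: "set zs \<inter> R = {}" using zs(2) dis by auto
  have zsM: "set zs \<inter> ({a, b} \<union> set M \<union> set ws) = {}" using zs(2,3) zsR wsR by blast
  have R'M: "R' \<inter> ({a, b} \<union> set M \<union> set ws) = {}" using R'(2) abR by blast
  obtain cs where cs: "chord R' z cs s1"
    using chord_exists[OF R'(1) att(1,4,3,6)] R'(2) att abR(4) by blast
  then have cs': "cs \<noteq> []" "set cs \<subseteq> R'" "successively E (z # cs @ [s1])" by (auto simp: chord_def)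
  then have h: "hd cs \<in> R'" "E (hd cs) z" using E_sym by (auto simp: successively_Cons)
  have "side {z, hd (cs @ [s1])} = (\<not> side {a, hd (zs @ [b])})"
    by (rule 2[OF zs(1) _ att(2,5) cs'(3)]) (use zsM R'M cs'(2) zsR R'(2) in blast)+
  moreover have "side {d, r2} = side {a, hd (zs @ [b])}"
    by (rule side_along[where side = side and E = E, OF 1 E_sym _ zsM]) (use zs d nd E_sym in \<open>auto simp: gpath_def\<close>)
  moreover obtain n where "walk_in E R' n (hd cs) r2" using R'(1) h d unfolding territory_def by blast
  then have "side {hd cs, z} = side {r2, d}"
    using side_walk_in[where side = side and E = E, OF 1 E_sym _ R'M] h d by blast
  ultimately show False using cs'(1) by (simp add: insert_commute)
qed

text \<open>A detour \<open>qs\<close> through \<open>R'\<close> separates the old detour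
  \<open>ws\<close> from the segment \<open>M\<close> within the territory. Otherwise
  \<open>M\<close>, \<open>ws\<close> and \<open>qs\<close> would be pairwise connected, each of
  them joined to both \<open>a\<close> and \<open>b\<close>, and these two to each other by the
  outer arc: the pattern of $K_5$.\<close>

lemma no_crossing:
  assumes L: "lens C (X @ a # M @ b # Y)" and C: "gpath C" and D: "gpath (X @ a # M @ b # Y)"
    and dis: "set C \<inter> R = {}" "set (X @ a # M @ b # Y) \<inter> R = {}"
    and ch: "chord R a ws b" "distinct ws"
    and R': "territory R'" "R' \<subseteq> R - set ws"
    and att: "r0 \<in> R'" "z \<in> set M" "E r0 z" "r1 \<in> R'" "s1 \<in> set ws" "E r1 s1"
    and ch': "chord R' a qs b" "distinct qs"
    and s: "s \<in> set ws" "z' \<in> set M" "walk_in E (R - set qs) n s z'"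
  shows False
proof -
  obtain zs where zs: "gpath (a # zs @ [b])" "set zs = (set C \<union> set X \<union> set Y) - {a, b}" "set zs \<inter> set M = {}"
    using lens_outer_path[OF L C D] .
  have wsR: "ws \<noteq> []" "set ws \<subseteq> R" "successively E ws" using ch
    by (auto simp: chord_def successively_append_iff successively_Cons)
  have wsE: "successively E (a # ws @ [b])" using ch(1) unfolding chord_def by blast
  have qsR: "qs \<noteq> []" "set qs \<subseteq> R'" using ch' by (auto simp: chord_def)
  have abR: "a \<notin> R" "b \<notin> R" "a \<noteq> b" "set M \<inter> R = {}" using dis(2) D by (auto simp: gpath_def)
  then have abR': "a \<notin> R'" "b \<notin> R'" using R'(2) by auto
  have gM: "gpath (a # M @ [b])"
  proof -
    have "gpath (a # M @ b # Y)" using D gpath_append by blast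
    then show ?thesis using gpath_append[of "a # M" b Y] by simp
  qed
  have Mqs: "set M \<inter> set qs = {}" using abR(4) qsR R'(2) by blast
  obtain side where 1: "\<And>v x y. \<lbrakk>v \<notin> {a, b} \<union> set M \<union> set qs; E v x; E v y\<rbrakk> \<Longrightarrow> side {v, x} = side {v, y}"
    and 2: "\<And>zs z cs w. \<lbrakk>gpath (a # zs @ [b]); set zs \<inter> (set M \<union> set qs) = {}; z \<in> set M; w \<in> set qs;
        successively E (z # cs @ [w]); set cs \<inter> ({a, b} \<union> set M \<union> set qs \<union> set zs) = {}\<rbrakk>
      \<Longrightarrow> side {z, hd (cs @ [w])} = (\<not> side {a, hd (zs @ [b])})"
    using path_sides[OF gM chord_gpath[OF ch' abR' abR(3)] Mqs] by blast
  have zsR: "set zs \<inter> R = {}" using zs(2) dis by auto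
  have zsJ: "set zs \<inter> (set M \<union> set qs) = {}" using zs(3) zsR qsR R'(2) by blast
  have wsJ: "set ws \<inter> ({a, b} \<union> set M \<union> set qs) = {}" using wsR(2) abR qsR(2) R'(2) by blast
  obtain q where q: "q \<in> set qs" "q \<in> R'" using qsR by (cases qs) auto
  \<comment> \<open>this connection avoids both \<open>ws\<close> and the outer arc, so these are on the same side\<close>
  have "\<exists>w cs. w \<in> set qs \<and> set cs \<subseteq> R' - set qs \<and> successively E (cs @ [w]) \<and> hd (cs @ [w]) = r0"
  proof -
    obtain m where "walk_in E R' m r0 q" using R'(1) att(1) q unfolding territory_def by blast
    from walk_in_cut[OF this q(1)] show ?thesis using walk_in_imp_list by metis
  qed
  then obtain w cs where cs: "w \<in> set qs" "set cs \<subseteq> R' - set qs" "successively E (cs @ [w])" "hd (cs @ [w]) = r0"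
    by blast
  have sz: "successively E (z # cs @ [w])" using cs att(3) E_sym by (auto simp: successively_Cons)
  have "side {z, hd (cs @ [w])} = (\<not> side {a, hd (zs @ [b])})"
    by (rule 2[OF zs(1) zsJ att(2) cs(1) sz]) (use cs(2) R'(2) abR zsR in blast)
  moreover have "side {z, hd (cs @ [w])} = (\<not> side {a, hd (ws @ [b])})"
    by (rule 2[OF chord_gpath[OF ch abR(1-3)] _ att(2) cs(1) sz]) (use cs(2) R'(2) abR wsJ in blast)+
  \<comment> \<open>this one runs through \<open>ws\<close> and avoids the outer arc, so these are on different sides\<close>
  moreover obtain w' ps where ps: "w' \<in> set qs" "chord (R - set qs) z' ps w'" "s \<in> set ps"
  proof -
    obtain m where "walk_in E R' m r1 q" using R'(1) att(4) q unfolding territory_def by blast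
    from walk_in_cut[OF this q(1)] obtain m' w' where w': "w' \<in> set qs" "walk_in E (R' - set qs) m' r1 w'" by blast
    then have "walk_in E (R - set qs) m' r1 w'" using walk_in_mono R'(2) by (metis Diff_mono Diff_subset order_refl subset_trans)
    moreover have s1: "s1 \<in> R - set qs" using att(5) wsR(2) wsJ by blast
    ultimately have "walk_in E (R - set qs) (Suc m') s1 w'" using walk_in_Suc E_sym att(6) by metis
    moreover obtain k where "walk_in E (set ws) k s s1" using walk_connected_set[OF wsR(3) s(1) att(5)] by blast
    then have "walk_in E (R - set qs) k s s1" by (rule walk_in_mono) (use wsR(2) wsJ in blast)
    ultimately have "walk_in E (R - set qs) (k + Suc m') s w'" using walk_in_trans by metis
    moreover have "s \<in> R - set qs" "z' \<notin> R - set qs" "w' \<notin> R - set qs" using s wsR(2) wsJ abR(4) w'(1) by blast+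
    ultimately obtain ps where "chord (R - set qs) z' ps w'" "s \<in> set ps" using chordI[OF s(3)] by metis
    then show thesis using that w'(1) by blast
  qed
  have psE: "successively E (z' # ps @ [w'])" "set ps \<subseteq> R - set qs" using ps(2) by (auto simp: chord_def)
  have psJ: "set ps \<inter> ({a, b} \<union> set M \<union> set qs) = {}" using psE(2) abR by blast
  have "side {z', hd (ps @ [w'])} = (\<not> side {a, hd (zs @ [b])})"
    by (rule 2[OF zs(1) zsJ s(2) ps(1) psE(1)]) (use psE(2) abR zsR in blast)
  moreover obtain t where t: "E s t"
  proof -
    obtain P Q where "ps = P @ s # Q" using split_list[OF ps(3)] by blast
    then have "successively E ((z' # P) @ s # (Q @ [w']))" using psE(1) by simp
    then have "successively E (s # Q @ [w'])" using successively_glue[of E "z' # P" s "Q @ [w']"] by simp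
    then show thesis using that by (auto simp: successively_Cons)
  qed
  have "side {s, t} = side {z', hd (ps @ [w'])}"
    by (rule side_along[where side = side and E = E, OF 1 E_sym psE(1) psJ ps(3) t])
  moreover have "side {s, t} = side {a, hd (ws @ [b])}"
    by (rule side_along[where side = side and E = E, OF 1 E_sym wsE wsJ s(1) t])
  ultimately show False by blast
qed

text \<open>The detour replaces a segment of \<open>D\<close>. A component without neighbours inside
  the segment is confined by \<open>C\<close>, which stays strict, and the rerouted path. Any other
  component is confined by segment and detour alone, by \<open>theta_faces\<close>, and there the
  minimal choice makes the segment strict.\<close>

lemma lens_advance:
  assumes b: "blockade R C D" and D: "D \<noteq> []"
    and att: "u \<in> set D" "v \<in> set D" "u \<noteq> v" "r \<in> R" "s \<in> R" "E r u" "E s v"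
  shows "\<exists>F. advance R C D F"
proof -
  note bd = blockadeD[OF b]
  have L: "lens C D" using bd(11) D by blast
  have dD: "distinct D" using bd(5) by (simp add: gpath_def)
  have DR: "D ! i \<notin> R" if "i < length D" for i using bd(8) that nth_mem by blast
  define M where "M x y = set (drop (Suc x) (take y D))" for x y
  define Ch where "Ch = (\<lambda>(x, y, ws). x < y \<and> y < length D \<and> chord R (D ! x) ws (D ! y))"
  \<comment> \<open>\<open>A\<close> is the part of the territory enclosed by the segment and the detour\<close>
  define A where "A = (\<lambda>(x, y, ws). {r \<in> R - set ws. \<exists>z\<in>M x y. \<exists>n. walk_in E (R - set ws) n r z})"
  \<comment> \<open>The first component is the excess length of the detour. Its truncated
    subtraction loses nothing, because \<open>geo\<close> below shows that the excess is never
    negative.\<close>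
  define ms where "ms = measures [\<lambda>(x, y, ws :: 'a list). length ws + 1 + x - y, \<lambda>(x, y, ws). y - x, \<lambda>t. card (A t)]"
  have "\<exists>t. Ch t"
  proof -
    obtain i j where ij: "i < length D" "D ! i = u" "j < length D" "D ! j = v"
      using att by (auto simp: in_set_conv_nth)
    have uvR: "u \<notin> R" "v \<notin> R" using att bd(8) by auto
    have "i \<noteq> j" using ij att by auto
    moreover obtain ws where "chord R u ws v" using chord_exists[OF bd(1) att(4-7) uvR] .
    moreover obtain ws' where "chord R v ws' u" using chord_exists[OF bd(1) att(5,4,7,6) uvR(2,1)] .
    ultimately have "Ch (i, j, ws) \<or> Ch (j, i, ws')" using ij by (auto simp: Ch_def)
    then show ?thesis by blast
  qed
  then obtain t where t: "Ch t" "\<And>t'. (t', t) \<in> ms \<Longrightarrow> \<not> Ch t'"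
    using wfE_min[of ms _ "Collect Ch"] unfolding ms_def by (metis mem_Collect_eq wf_measures)
  obtain x y ws where txy: "t = (x, y, ws)" by (cases t)
  have xy: "x < y" "y < length D" and ch: "chord R (D ! x) ws (D ! y)" using t(1) txy by (auto simp: Ch_def)
  have geo: "y' \<le> x' + length ws' + 1" if c: "Ch (x', y', ws')" for x' y' ws'
  proof -
    have c: "x' < length D" "y' < length D" "chord R (D ! x') ws' (D ! y')" using c by (auto simp: Ch_def)
    then have "0 < length ws'" "ws' ! 0 \<in> R" by (auto simp: chord_def)
    with chord_walk_in[OF c(3), of 0] bd(10) c show ?thesis unfolding geodesic_def by fastforce
  qed
  have min: "length ws + 1 + x - y \<le> length ws' + 1 + x' - y'"
    "length ws + 1 + x - y = length ws' + 1 + x' - y' \<Longrightarrow> y - x \<le> y' - x'"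
    "length ws + 1 + x - y = length ws' + 1 + x' - y' \<Longrightarrow> y - x = y' - x' \<Longrightarrow>
      card (A (x, y, ws)) \<le> card (A (x', y', ws'))" if "Ch (x', y', ws')" for x' y' ws'
    using t(2)[of "(x', y', ws')"] that unfolding txy ms_def in_measures by force+
  \<comment> \<open>Cutting a loop out of a detour would lower its excess below the minimum.\<close>
  have dist: "distinct ws'" if c: "Ch (x', y', ws')" "length ws' + 1 + x' - y' = length ws + 1 + x - y" for x' y' ws'
  proof (rule ccontr)
    assume "\<not> distinct ws'"
    then obtain ws2 where w: "chord R (D ! x') ws2 (D ! y')" "length ws2 < length ws'"
      using chord_shorten c(1) unfolding Ch_def by blast
    then have "Ch (x', y', ws2)" using c(1) unfolding Ch_def by auto
    from min(1)[OF this] geo[OF this] c(2) w(2) show False by linarith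
  qed
  have dws: "distinct ws" using dist[of x y ws] t(1) txy by simp
  let ?a = "D ! x" and ?b = "D ! y"
  define X where "X = take x D"
  define N where "N = drop (Suc x) (take y D)"
  define Y where "Y = drop (Suc y) D"
  have Ddec: "D = X @ ?a # N @ ?b # Y"
  proof -
    have "take y D = take x (take y D) @ take y D ! x # drop (Suc x) (take y D)"
      using xy by (intro id_take_nth_drop) simp
    then have "take y D = X @ ?a # N" using xy unfolding X_def N_def by (simp add: min_def)
    moreover have "D = take y D @ ?b # Y" unfolding Y_def using xy(2) by (rule id_take_nth_drop)
    ultimately show ?thesis by (metis append.assoc append_Cons)
  qed
  have MN: "M x y = set N" unfolding M_def N_def ..
  have lX: "length X = x" unfolding X_def using xy by simp
  have lN: "length N = y - Suc x" unfolding N_def using xy by simp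
  let ?F = "X @ ?a # ws @ ?b # Y"
  have wsR: "set ws \<subseteq> R" "ws \<noteq> []" using ch by (auto simp: chord_def)
  have abR: "?a \<notin> R" "?b \<notin> R" "?a \<noteq> ?b" using DR xy dD by (auto simp: nth_eq_iff_index_eq)
  have gD: "gpath (X @ ?a # N @ ?b # Y)" using bd(5) Ddec by metis
  have LD: "lens C (X @ ?a # N @ ?b # Y)" using L Ddec by metis
  have disD: "set (X @ ?a # N @ ?b # Y) \<inter> R = {}" using bd(8) Ddec by metis
  have setD: "set D = set X \<union> {?a} \<union> set N \<union> {?b} \<union> set Y" by (subst Ddec) auto
  have sX: "sublist (X @ [?a]) D" unfolding sublist_def
    by (intro exI[of _ "[]"] exI[of _ "N @ ?b # Y"]) (use Ddec in simp)
  have sY: "sublist (?b # Y) D" unfolding sublist_def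
    by (intro exI[of _ "X @ ?a # N"] exI[of _ "[]"]) (use Ddec in simp)
  let ?S = "?a # N @ [?b]"
  have sS: "sublist ?S D" unfolding sublist_def
    by (intro exI[of _ "X"] exI[of _ "Y"]) (use Ddec in simp)
  have gS: "gpath ?S"
  proof -
    have "gpath (?a # N @ ?b # Y)" using gD gpath_append by blast
    then show ?thesis using gpath_append[of "?a # N" ?b Y] by simp
  qed
  have gw: "gpath (?a # ws @ [?b])" by (rule chord_gpath[OF ch dws abR])
  have gF: "gpath ?F"
  proof -
    have p: "gpath (X @ [?a])" "gpath (?b # Y)"
      using gD gpath_append[of X ?a "N @ ?b # Y"] gpath_append[of "X @ ?a # N" ?b Y] by simp_all
    have dd: "distinct (X @ ?a # N @ ?b # Y)" using gD by (simp add: gpath_def)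
    have "set ws \<inter> set D = {}" using wsR bd(8) by blast
    then have "gpath ((?a # ws) @ ?b # Y)" using p gw dd setD
      by (intro gpath_append[THEN iffD2]) auto
    then show ?thesis using p dd setD \<open>set ws \<inter> set D = {}\<close>
      by (intro gpath_append[THEN iffD2]) auto
  qed
  \<comment> \<open>Two walks from \<open>r\<close> to vertices of \<open>D\<close> on both sides of
    the segment form a detour of their own. That its excess is at least the minimal one is the
    inequality to be shown.\<close>
  have Fgeo: "geodesic E R ?F"
  proof (rule geodesic_splice[OF ch geodesic_sublist[OF bd(10) sX] geodesic_sublist[OF bd(10) sY]])
    fix r p q m n
    assume *: "r \<in> R" "p \<le> length X" "q \<le> length Y" "walk_in E R m r ((X @ [?a]) ! p)" "walk_in E R n r ((?b # Y) ! q)"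
    have p: "(X @ [?a]) ! p = D ! p" using *(2) lX unfolding X_def by (auto simp: nth_append)
    have q: "(?b # Y) ! q = D ! (y + q)" unfolding Y_def using xy(2) *(3) by (cases q) (auto simp: Y_def)
    have yq: "y + q < length D" using *(3) xy(2) unfolding Y_def by auto
    then obtain ws' where w: "chord R (D ! p) ws' (D ! (y + q))" "Suc (length ws') = m + n"
      using chordI[OF *(4,5)[unfolded p q] *(1)] DR *(2) lX xy by (metis le_less_trans less_trans)
    then have "Ch (p, y + q, ws')" using *(2) lX xy yq by (auto simp: Ch_def)
    from min(1)[OF this] geo[OF this] geo[OF t(1)[unfolded txy]]
    show "length X + Suc (length ws) + q \<le> p + m + n" using w(2) lX by linarith
  qed
  have FR: "set ?F \<inter> R = set ws" using disD wsR by auto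
  have "advance R C D ?F" unfolding advance_def
  proof (intro conjI allI impI)
    show "set ?F \<inter> R \<noteq> {}" using FR wsR by simp
    fix R' assume R': "territory R'" "R' \<subseteq> R - set ?F" "\<forall>r\<in>R'. \<forall>v\<in>R. E r v \<longrightarrow> v \<in> R' \<union> set ?F"
    have sub: "R' \<subseteq> R" and subw: "R' \<subseteq> R - set ws" using R'(2) by auto
    \<comment> \<open>A walk in the connected set \<open>R\<close> from \<open>R'\<close> to the
      detour can leave \<open>R'\<close> only at a vertex of the detour.\<close>
    obtain r1 s1 where r1: "r1 \<in> R'" "s1 \<in> set ws" "E r1 s1"
    proof -
      obtain r' s' where rs: "r' \<in> R'" "s' \<in> set ws" using R'(1) wsR unfolding territory_def by fastforce
      then obtain n where "walk_in E R n r' s'" using bd(1) sub wsR unfolding territory_def by blast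
      moreover have "s' \<in> R - R'" using rs wsR R'(2) by auto
      ultimately obtain p q where "p \<in> R'" "q \<in> R - R'" "E p q" using walk_in_exit rs by metis
      then show thesis using that R'(3) FR by blast
    qed
    show "\<exists>D1 D2 A B. blockade R' D1 D2 \<and> sublist D1 A \<and> sublist D2 B \<and>
        (A, B) \<in> {(C, D), (D, C), (C, ?F), (?F, C), (D, ?F), (?F, D)}"
    proof (cases "\<exists>r0\<in>R'. \<exists>z\<in>set N. E r0 z")
      case False
      have "blockade R' C ?F" unfolding blockade_def
      proof (intro conjI ballI allI impI)
        fix r w assume r: "r \<in> R'" "E r w"
        then have "w \<in> R \<union> set C \<union> set D" using bd(12) sub by blast
        moreover have "w \<notin> set N" using False r by blast
        ultimately show "w \<in> R' \<union> set C \<union> set ?F" using R'(3) r setD by auto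
      next
        have "hd ?F = hd (X @ ?a # N @ ?b # Y)" by (cases X) auto
        moreover have "last ?F = last (X @ ?a # N @ ?b # Y)" by simp
        ultimately have "hd ?F = hd D" "last ?F = last D" using Ddec by metis+
        moreover have "set C \<inter> set ?F = set C \<inter> set D"
        proof -
          have "hd ?F \<in> set ?F" "last ?F \<in> set ?F" by (rule hd_in_set, simp) (rule last_in_set, simp)
          then have ends: "hd D \<in> set ?F" "last D \<in> set ?F"
            unfolding \<open>hd ?F = hd D\<close> \<open>last ?F = last D\<close> .
          have CD: "set C \<inter> set D = {hd D, last D}" using L unfolding lens_def by metis
          have "w \<in> set D" if "w \<in> set C" "w \<in> set ?F" for w
          proof -
            have "w \<notin> set ws" using that(1) wsR(1) bd(7) by (metis IntI empty_iff subsetD)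
            then show ?thesis using that(2) setD by auto
          qed
          then have "set C \<inter> set ?F \<subseteq> set C \<inter> set D" by (metis IntE IntI subsetI)
          moreover have "set C \<inter> set D \<subseteq> set C \<inter> set ?F"
          proof -
            have "{hd D, last D} \<subseteq> set ?F" using ends by (metis empty_subsetI insert_subset)
            then show ?thesis unfolding CD[symmetric] by (metis Int_lower1 Int_greatest)
          qed
          ultimately show ?thesis by (rule subset_antisym)
        qed
        moreover have "C \<noteq> []" "hd C = hd D" "last C = last D" "hd D \<noteq> last D" "set C \<inter> set D = {hd D, last D}"
          using L unfolding lens_def by metis+
        ultimately show "?F = [] \<or> lens C ?F" unfolding lens_def by simp
      qed (use R' bd gF sub geodesic_subset[OF Fgeo sub] strict_geodesic_subset[OF bd(9) sub] in auto)
      moreover have "sublist C C" "sublist ?F ?F" by auto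
      ultimately show ?thesis by blast
    next
      case True
      then obtain r0 z where r0: "r0 \<in> R'" "z \<in> set N" "E r0 z" by blast
      have strict: "strict_geodesic E R' ?S"
      proof (rule ccontr)
        assume "\<not> strict_geodesic E R' ?S"
        then obtain r i j m n where *: "r \<in> R'" "i < length ?S" "j < length ?S" "walk_in E R' m r (?S ! i)"
           "walk_in E R' n r (?S ! j)" "i + m + n \<le> j" unfolding strict_geodesic_def by (meson not_less)
        have nth: "?S ! k = D ! (x + k) \<and> x + k \<le> y" if "k < length ?S" for k
        proof -
          have "D = X @ ?S @ Y" using Ddec by simp
          then have "D ! (x + k) = (X @ ?S @ Y) ! (x + k)" by metis
          also have "\<dots> = (?S @ Y) ! k" using lX nth_append_length_plus by metis
          also have "\<dots> = ?S ! k" using that by (metis nth_append)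
          finally show ?thesis using that lN xy by simp
        qed
        have nR: "?S ! i \<notin> R'" "?S ! j \<notin> R'" using nth *(2,3) DR xy(2) sub by (metis le_less_trans subsetD)+
        have "0 < m" "0 < n" using walk_in_attached(1) * nR by metis+
        obtain qs where qs: "chord R' (?S ! i) qs (?S ! j)" "Suc (length qs) = m + n"
          using chordI[OF *(4,5,1) nR] by metis
        have Cq: "Ch (x + i, x + j, qs)"
          using qs(1) nth[OF *(2)] nth[OF *(3)] *(6) \<open>0 < m\<close> xy(2) chord_mono[OF _ sub] unfolding Ch_def by auto
        \<comment> \<open>The violating detour has excess 0, so the minimal excess is 0 as well. The
          tie is then decided by the segment length, and since the segment of \<open>qs\<close> is
          part of that of \<open>ws\<close>, both have the same ends.\<close>
        have e0: "length qs + 1 + (x + i) - (x + j) = 0" using qs(2) *(6) by simp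
        then have e: "length ws + 1 + x - y = length qs + 1 + (x + i) - (x + j)" using min(1)[OF Cq] by simp
        have "y - x \<le> j - i" using min(2)[OF Cq e] by simp
        then have ij: "i = 0" "x + j = y" using nth[OF *(3)] xy by auto
        have Cq': "Ch (x, y, qs)" and chq: "chord R' ?a qs ?b" and e': "length qs + 1 + x - y = length ws + 1 + x - y"
          using Cq e ij qs(1) nth[OF *(2)] nth[OF *(3)] by auto
        have dq: "distinct qs" using dist[OF Cq' e'] .
        have qsR: "set qs \<subseteq> R'" "qs \<noteq> []" using chq by (auto simp: chord_def)
        \<comment> \<open>A walk that reaches the segment without \<open>qs\<close> never meets
          \<open>ws\<close>, by \<open>no_crossing\<close>, so it stays in the region enclosed by
          \<open>ws\<close>.\<close>
        have "A (x, y, qs) \<subseteq> A (x, y, ws)"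
        proof
          fix r assume "r \<in> A (x, y, qs)"
          then obtain z' n where r: "r \<in> R - set qs" "z' \<in> set N" "walk_in E (R - set qs) n r z'"
            unfolding A_def by (auto simp: MN)
          have no: False if "s \<in> set ws" "walk_in E (R - set qs) k s z'" for s k
            by (rule no_crossing[OF LD bd(4) gD bd(7) disD ch dws R'(1) subw r0 r1 chq dq that(1) r(2) that(2)])
          then have rws: "r \<notin> set ws" using r(3) by blast
          have "walk_in E (R - set qs - set ws) n r z'" using walk_in_avoid[OF r(3), of "set ws"] no by blast
          then have "walk_in E (R - set ws) n r z'" by (rule walk_in_mono) auto
          then show "r \<in> A (x, y, ws)" using r rws unfolding A_def by (auto simp: MN)
        qed
        \<comment> \<open>The vertices of \<open>qs\<close> are in the old region, since
          \<open>R'\<close> is connected, avoids \<open>ws\<close> and has the neighbour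
          \<open>z\<close> on the segment; they are not in their own region.\<close>
        moreover have "\<exists>q\<in>A (x, y, ws). q \<notin> A (x, y, qs)"
        proof -
          obtain q where q: "q \<in> set qs" using qsR by (cases qs) auto
          then obtain k where "walk_in E R' k q r0" using R'(1) qsR r0 unfolding territory_def by blast
          then have "walk_in E R' (k + 1) q z" using walk_in_trans walk_in_1 r0 by metis
          then have "walk_in E (R - set ws) (k + 1) q z" using walk_in_mono subw by metis
          then have "q \<in> A (x, y, ws)" using r0 q qsR subw unfolding A_def by (auto simp: MN)
          then show ?thesis using q unfolding A_def by auto
        qed
        ultimately have "A (x, y, qs) \<subset> A (x, y, ws)" by blast
        moreover have "finite (A (x, y, ws))"
          by (rule finite_subset[OF _ finite_subset[OF bd(2) finite_V]]) (auto simp: A_def)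
        ultimately have "card (A (x, y, qs)) < card (A (x, y, ws))" by (rule psubset_card_mono[rotated])
        with min(3)[OF Cq'] e' show False by simp
      qed
      let ?W = "?a # ws @ [?b]"
      have sW: "sublist ?W ?F" unfolding sublist_def by (intro exI[of _ X] exI[of _ Y]) simp
      have "blockade R' ?S ?W" unfolding blockade_def
      proof (intro conjI ballI allI impI)
        fix r w assume r: "r \<in> R'" "E r w"
        then have "w \<in> R \<union> set C \<union> set D" using bd(12) sub by blast
        moreover have "w \<in> {?a, ?b}" if "w \<in> set C \<union> set X \<union> set Y"
          by (rule theta_faces[OF LD bd(4) gD bd(7) disD ch dws R'(1) subw r0 r1 r that])
        moreover have "w \<in> R' \<union> set ws" if "w \<in> R" using R'(3) r that FR by blast
        ultimately show "w \<in> R' \<union> set ?S \<union> set ?W" using setD by auto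
      next
        show "set ?S \<inter> R' = {}" "set ?W \<inter> R' = {}" using disD sub subw by auto
        have "set N \<inter> set ws = {}" "?a \<notin> set N" "?b \<notin> set N" "?a \<notin> set ws" "?b \<notin> set ws"
          using disD wsR gS gw by (auto simp: gpath_def)
        then show "?W = [] \<or> lens ?S ?W" using abR(3) unfolding lens_def by auto
        show "geodesic E R' ?W" by (rule geodesic_sublist[OF geodesic_subset[OF Fgeo sub] sW])
      qed (use R' gS gw strict in simp_all)
      then show ?thesis using sS sW by blast
    qed
  qed (use gF Fgeo in simp_all)
  then show ?thesis ..
qed

text \<open>The chord from \<open>x\<close> on \<open>C\<close> to \<open>y\<close> on
  \<open>D\<close> divides the cycle into two cycles. This is the one through the common start of
  \<open>C\<close> and \<open>D\<close>.\<close>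

lemma lens_prefix:
  assumes L: "lens C (D' @ y # Y)" and C: "C = X @ x # X'" "distinct C" and D: "distinct (D' @ y # Y)"
    and xy: "x \<notin> set (D' @ y # Y)" "y \<notin> set C" and ws: "set ws \<inter> set (D' @ y # Y) = {}"
  shows "lens (D' @ [y]) (X @ x # ws @ [y])"
proof -
  let ?D = "D' @ y # Y"
  have l: "hd C = hd ?D" "last C = last ?D" "set C \<inter> set ?D = {hd C, last C}"
    using L by (auto simp: lens_def)
  have hC: "hd C \<in> set C \<inter> set ?D" "last C \<in> set C \<inter> set ?D" using l(3) by auto
  have D': "D' \<noteq> []" using hC(1) l(1) xy(2) by (cases D') auto
  have X: "X \<noteq> []" using hC(1) C(1) xy(1) by (cases X) auto
  have hd: "hd (D' @ [y]) = hd C" "hd (X @ x # ws @ [y]) = hd C" "hd C \<in> set D'" "hd C \<in> set X"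
    using D' X l(1) C(1) by (cases D'; cases X; simp)+
  have "last C \<notin> set (X @ [x])"
  proof -
    have "X' \<noteq> []" using hC(2) C(1) xy(1) by auto
    then have "last C \<in> set X'" using C(1) by simp
    then show ?thesis using C by auto
  qed
  then have "set (X @ [x]) \<inter> set ?D \<subseteq> {hd C}" using l(3) C(1) by auto
  then have "set (D' @ [y]) \<inter> set (X @ x # ws @ [y]) = {hd C, y}"
    using hd ws xy C(1) by auto
  moreover have "hd C \<noteq> y" using hC(1) xy(2) by blast
  ultimately show ?thesis using hd unfolding lens_def by simp
qed

lemma sublist_gpath: "gpath D \<Longrightarrow> sublist C D \<Longrightarrow> gpath C"
  unfolding gpath_def sublist_def by (auto simp: successively_append_iff)

text \<open>Only vertices with neighbours in the territory (\<open>att\<close>) constrain the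
  guards. Two such vertices on \<open>D\<close> allow \<open>lens_advance\<close>. If
  \<open>D\<close> has at most one, it is strict by itself, so \<open>C\<close> and \<open>D\<close>
  may exchange their roles. Exactly one on each path, neither of them common to both, is settled by
  a shortest chord between the two.\<close>

lemma advance_exists:
  assumes b: "blockade R C D"
  shows "\<exists>F. advance R C D F"
proof -
  note bd = blockadeD[OF b]
  define att where "att w \<longleftrightarrow> (\<exists>r\<in>R. E r w)" for w
  have attR: "w \<notin> R" if "w \<in> set C \<union> set D" for w using that bd(7,8) by blast
  have strictI: "strict_geodesic E R L" if "set L \<inter> R = {}" "distinct L"
      "\<And>u v. \<lbrakk>u \<in> set L; v \<in> set L; att u; att v\<rbrakk> \<Longrightarrow> u = v" for L
    by (rule few_attached_strict[OF that(1)])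
      (use that(2,3) in \<open>metis att_def nth_eq_iff_index_eq nth_mem\<close>)
  have "\<exists>x\<in>set C \<union> set D. att x"
  proof -
    obtain r where r: "r \<in> R" using bd(3) by blast
    have h: "hd C \<in> set C" "hd C \<in> V" using bd(4,6) by (auto simp: gpath_def)
    then have hR: "hd C \<in> V - R" using attR by blast
    obtain ps where ps: "successively E (ps @ [hd C])" "hd (ps @ [hd C]) = r"
      using walk_exists r bd(2) h(2) by (metis subsetD)
    have "set ps \<subseteq> set (ps @ [hd C])" by auto
    also have "\<dots> \<subseteq> V"
    proof (cases ps)
      case (Cons p qs)
      then have "set (ps @ [hd C]) = \<Union> (pedges (ps @ [hd C]))" using Union_pedges[of "ps @ [hd C]"] by simp
      also have "\<dots> \<subseteq> V" using pedges_graph[OF sg ps(1)] by (auto simp: graph_edges_def)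
      finally show ?thesis .
    qed (use h in simp)
    finally have "walk_in E V (length ps) r (hd C)" using list_imp_walk_in[OF ps(1)] ps(2) by metis
    from walk_in_exit[OF this r hR] obtain u v where "u \<in> R" "v \<in> V - R" "E u v" by blast
    then show ?thesis using bd(12)[of u v] unfolding att_def by blast
  qed
  then obtain x where x: "x \<in> set C \<union> set D" "att x" by blast
  consider (single) "\<And>y. y \<in> set C \<union> set D \<Longrightarrow> att y \<Longrightarrow> y = x"
    | (two) u v where "u \<in> set D" "v \<in> set D" "u \<noteq> v" "att u" "att v"
    | (left) u v where "u \<in> set C" "v \<in> set C" "u \<noteq> v" "att u" "att v"
        "\<And>u v. \<lbrakk>u \<in> set D; v \<in> set D; att u; att v\<rbrakk> \<Longrightarrow> u = v"
    | (cross) u v where "u \<in> set C" "v \<in> set D" "u \<notin> set D" "v \<notin> set C" "att u" "att v"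
        "\<And>y. y \<in> set C \<union> set D \<Longrightarrow> att y \<Longrightarrow> y = u \<or> y = v"
  proof -
    show thesis
    proof (cases "\<exists>u v. u \<in> set D \<and> v \<in> set D \<and> u \<noteq> v \<and> att u \<and> att v")
      case True
      then show thesis using two by blast
    next
      case False
      then have uD: "u = v" if "u \<in> set D" "v \<in> set D" "att u" "att v" for u v using that by blast
      show thesis
      proof (cases "\<exists>u v. u \<in> set C \<and> v \<in> set C \<and> u \<noteq> v \<and> att u \<and> att v")
        case True
        then show thesis using left uD by blast
      next
        case False
        then have uC: "u = v" if "u \<in> set C" "v \<in> set C" "att u" "att v" for u v using that by blast
        have cr: thesis if h: "u \<in> set C" "v \<in> set D" "u \<noteq> v" "att u" "att v" for u v
        proof (rule cross[OF h(1,2) _ _ h(4,5)])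
          show "u \<notin> set D" using uD[OF _ h(2,4,5)] h(3) by blast
          show "v \<notin> set C" using uC[OF h(1) _ h(4,5)] h(3) by blast
          show "y = u \<or> y = v" if "y \<in> set C \<union> set D" "att y" for y
            using uC[OF _ h(1) that(2) h(4)] uD[OF _ h(2) that(2) h(5)] that(1) by blast
        qed
        show thesis
        proof (cases "\<exists>y\<in>set C \<union> set D. att y \<and> y \<noteq> x")
          case True
          then obtain y where y: "y \<in> set C \<union> set D" "att y" "y \<noteq> x" by blast
          then show thesis using cr[of x y] cr[of y x] x uC[of x y] uD[of x y] by blast
        next
          case False
          then show thesis using single by blast
        qed
      qed
    qed
  qed
  then show ?thesis
  proof cases
    case single
    obtain s where s: "s \<in> R" "E s x" using x(2) unfolding att_def by blast
    have "v \<in> R \<or> v = x" if "r \<in> R" "E r v" for r v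
      using bd(12)[OF that] single[of v] that unfolding att_def by blast
    then show ?thesis using advance_single[OF b attR[OF x(1)] s] by blast
  next
    case two
    then show ?thesis using lens_advance[OF b] unfolding att_def by (metis empty_iff list.set(1))
  next
    case left
    show ?thesis
    proof (cases "D = []")
      case False
      have "strict_geodesic E R D" using strictI bd(5,8) left(6) by (simp add: gpath_def)
      then have "blockade R D C"
        using b False bd(11) strict_geodesic_imp_geodesic[OF bd(9)] unfolding blockade_def lens_def by auto
      then have "\<exists>F. advance R D C F" using lens_advance[OF _ bd(6)] left(1-5) unfolding att_def by blast
      then show ?thesis using advance_commute by blast
    next
      case True
      \<comment> \<open>The first and, below, the last attached vertex of \<open>C\<close>: the
        segment between them contains all attached vertices, and a shortest chord closes it to a
        cycle.\<close>
      obtain X u Z where C1: "C = X @ u # Z" "att u" "\<forall>x\<in>set X. \<not> att x"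
        using split_list_first_prop[of C att] left(1,4) by blast
      have "\<exists>v\<in>set Z. att v" using left(1-5) C1 by auto
      then obtain M v Y where Z: "Z = M @ v # Y" "att v" "\<forall>y\<in>set Y. \<not> att y"
        using split_list_last_prop[of Z att] by blast
      let ?D = "u # M @ [v]"
      have Cs: "C = X @ ?D @ Y" using C1 Z by simp
      then have sub: "sublist ?D C" unfolding sublist_def by blast
      have gD: "gpath ?D" using sublist_gpath[OF bd(4) sub] .
      then have uv: "u \<noteq> v" by (auto simp: gpath_def)
      have uvR: "u \<notin> R" "v \<notin> R" using Cs attR by auto
      obtain r s where rs: "r \<in> R" "s \<in> R" "E r u" "E s v" using C1(2) Z(2) unfolding att_def by blast
      obtain ws0 where "chord R u ws0 v" using chord_exists[OF bd(1) rs uvR] .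
      then obtain ws where ws: "chord R u ws v" "distinct ws" "\<And>ws'. chord R u ws' v \<Longrightarrow> length ws \<le> length ws'"
        using shortest_chord by blast
      have gw: "gpath (u # ws @ [v])" using chord_gpath[OF ws(1,2) uvR uv] .
      have wsR: "set ws \<subseteq> R" using ws(1) by (auto simp: chord_def)
      have DR: "set ?D \<inter> R = {}" using bd(7) Cs by auto
      have "advance R C D ([] @ u # ws @ [v])"
      proof (rule shortest_chord_advance[OF b ws uvR uv _ _ _ _ sub _ gD strict_geodesic_sublist[OF bd(9) sub] DR])
        show "gpath ([] @ [u])" using gD by (simp add: gpath_def)
        show "lens ?D ([] @ u # ws @ [v])" using uv wsR DR gD gw unfolding lens_def gpath_def by auto
        fix r w assume r: "r \<in> R" "E r w"
        then have "w \<in> R \<union> set C" "att w" using bd(12)[OF r] True unfolding att_def by auto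
        then show "w \<in> R \<union> {u, v} \<union> set ?D" using Cs C1(3) Z(3) by auto
      qed auto
      then show ?thesis by blast
    qed
  next
    case cross
    have uvR: "u \<notin> R" "v \<notin> R" "u \<noteq> v" using cross attR by auto
    have L: "lens C D" using bd(11) cross(2) by auto
    obtain X X' where C: "C = X @ u # X'" using split_list[OF cross(1)] by blast
    obtain D' Y where D: "D = D' @ v # Y" using split_list[OF cross(2)] by blast
    obtain r s where rs: "r \<in> R" "s \<in> R" "E r u" "E s v" using cross(5,6) unfolding att_def by blast
    obtain ws0 where "chord R u ws0 v" using chord_exists[OF bd(1) rs uvR(1,2)] .
    then obtain ws where ws: "chord R u ws v" "distinct ws" "\<And>ws'. chord R u ws' v \<Longrightarrow> length ws \<le> length ws'"
      using shortest_chord by blast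
    have wsR: "set ws \<subseteq> R" using ws(1) by (auto simp: chord_def)
    have sub: "sublist (D' @ [v]) D" unfolding sublist_def D by (intro exI[of _ "[]"] exI[of _ Y]) simp
    have subC: "sublist (X @ [u]) C" unfolding sublist_def C by (intro exI[of _ "[]"] exI[of _ X']) simp
    have noC: "y = u" if "y \<in> set C" "att y" for y using cross(4,7) that by blast
    have noD: "y = v" if "y \<in> set D" "att y" for y using cross(3,7) that by blast
    have dC: "distinct C" "distinct D" using bd(4,5) by (simp_all add: gpath_def)
    \<comment> \<open>\<open>D\<close> has the single attached vertex \<open>v\<close>, so it is
      strict whether or not \<open>C\<close> is.\<close>
    have strD: "strict_geodesic E R D" by (rule strictI[OF bd(8) dC(2)]) (use noD in blast)
    have "advance R C D (X @ u # ws @ [v])"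
    proof (rule shortest_chord_advance[OF b ws uvR _ _ _ _ sub _ sublist_gpath[OF bd(5) sub] strict_geodesic_sublist[OF strD sub]])
      show "gpath (X @ [u])" using sublist_gpath[OF bd(4) subC] .
      show "set X \<inter> R = {}" using bd(7) C by auto
      show "v \<notin> set X" using cross(4) C by auto
      show "\<not> E r x" if "r \<in> R" "x \<in> set X" for r x
      proof
        assume "E r x"
        then have "x = u" using noC[of x] that C unfolding att_def by auto
        then show False using that(2) dC(1) C by auto
      qed
      show "set (D' @ [v]) \<inter> R = {}" using bd(8) D by auto
      show "lens (D' @ [v]) (X @ u # ws @ [v])"
        by (rule lens_prefix[of C D' v Y X u X' ws]) (use L C D dC cross bd(8) wsR in auto)
      show "w \<in> R \<union> {u, v} \<union> set (D' @ [v])" if "r \<in> R" "E r w" for r w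
        using bd(12)[OF that] cross(7)[of w] that unfolding att_def by blast
    qed simp_all
    then show ?thesis by blast
  qed
qed

end

theorem theorem4p4:
  fixes V :: "'a set" and E :: "'a \<Rightarrow> 'a \<Rightarrow> bool"
  assumes "simple_graph V E" and "connected_graph V E" and "planar_graph V E"
  shows "cop_number_k 2 V E \<le> 3"
proof -
  interpret planar_cop_graph V E
    by unfold_locales (rule assms)+
  have "cops_win V E 2 3"
    by (rule three_cops_win) (rule advance_exists)
  then show ?thesis
    unfolding cop_number_k_def by (rule Least_le)
qed

end
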